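(* Let $[a,b]\subset\mathbb{R}$ be a compact interval, let $n\geq 0$, $r\geq 1$, $m\geq 1$ be integers, and let $\varepsilon_0>0$. For every $\varepsilon\in[0,\varepsilon_0)$ let matrix-valued functions $K_{r-j}(\cdot,\varepsilon)\in(C^{(n)})^{m\times m}$, $j\in\{1,\ldots,r\}$, and a continuous linear operator $B(\varepsilon):(C^{(n+r)})^m\to\mathbb{C}^{rm}$ be given, and consider the boundary-value problem $$L(\varepsilon)z(t,\varepsilon)\equiv z^{(r)}(t,\varepsilon)+\sum_{j=1}^{r}K_{r-j}(t,\varepsilon)z^{(r-j)}(t,\varepsilon)=f(t,\varepsilon),\quad a\leq t\leq b,\qquad B(\varepsilon)z(\cdot,\varepsilon)=q(\varepsilon),$$ with unknown $z(\cdot,\varepsilon)\in(C^{(n+r)})^m$ and right-hand sides $f(\cdot,\varepsilon)\in(C^{(n)})^m$, $q(\varepsilon)\in\mathbb{C}^{rm}$. Suppose that: (0) the limiting homogeneous problem $L(0)z=0$ on $[a,b]$, $B(0)z=0$ has only the trivial solution $z\in(C^{(n+r)})^m$; (I) $K_{r-j}(\cdot,\varepsilon)\to K_{r-j}(\cdot,0)$ in $(C^{(n)})^{m\times m}$ as $\varepsilon\to0+$ for each $j\in\{1,\ldots,r\}$; (II) $B(\varepsilon)z\to B(0)z$ in $\mathbb{C}^{rm}$ as $\varepsilon\to0+$ for every $z\in(C^{(n+r)})^m$. Let $\varepsilon_1\in(0,\varepsilon_0)$ be a number such that for every $\varepsilon\in[0,\varepsilon_1)$ and all $f(\cdot,\varepsilon)\in(C^{(n)})^m$,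 $q(\varepsilon)\in\mathbb{C}^{rm}$ the problem has a unique solution $z(\cdot,\varepsilon)\in(C^{(n+r)})^m$ (such a number exists under conditions (0), (I), (II)). Then there exist positive numbers $\varepsilon_2<\varepsilon_1$ and $\varkappa_1,\varkappa_2$ such that for every $\varepsilon\in(0,\varepsilon_2)$ the two-sided estimate $$\varkappa_1\,d_n(\varepsilon)\leq\|z(\cdot,0)-z(\cdot,\varepsilon)\|_{(n+r)}\leq\varkappa_2\,d_n(\varepsilon)$$ holds, where $z(\cdot,0)$ and $z(\cdot,\varepsilon)$ are the solutions of the problem for the parameter values $0$ and $\varepsilon$ and $$d_n(\varepsilon):=\|L(\varepsilon)z(\cdot,0)-f(\cdot,\varepsilon)\|_{(n)}+\|B(\varepsilon)z(\cdot,0)-q(\varepsilon)\|_{\mathbb{C}^{rm}}.$$ Here the numbers $\varepsilon_2,\varkappa_1,\varkappa_2$ do not depend on $z(\cdot,0)$ and $z(\cdot,\varepsilon)$ (that is, they are the same for all right-hand sides $f$ and $q$).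
   Context: For an integer $l\geq0$, $C^{(l)}=C^{(l)}([a,b],\mathbb{C})$ is the Banach space of $l$ times continuously differentiable functions $x:[a,b]\to\mathbb{C}$ with norm $\|x\|_{(l)}=\sum_{j=0}^{l}\max\{|x^{(j)}(t)|:t\in[a,b]\}$; $(C^{(l)})^{m}=C^{(l)}([a,b],\mathbb{C}^m)$ and $(C^{(l)})^{m\times m}=C^{(l)}([a,b],\mathbb{C}^{m\times m})$ are the Banach spaces of vector-valued and matrix-valued functions with components in $C^{(l)}$, with norm, also denoted $\|\cdot\|_{(l)}$, equal to the sum of the $\|\cdot\|_{(l)}$-norms of all components. Derivatives of $z(\cdot,\varepsilon)$ are with respect to $t$. $\|\cdot\|_{\mathbb{C}^{rm}}$ is a fixed norm on $\mathbb{C}^{rm}$ (the sum of absolute values of the components). *)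

theory Defs
  imports "HOL-Analysis.Analysis"
begin

text \<open>Functions on the interval from \<open>a\<close> to \<open>b\<close> are represented by total functions on the reals, of
  which only the values on \<open>{a..b}\<close> matter; equality of such functions is agreement on \<open>{a..b}\<close>.
  Derivatives are taken within \<open>{a..b}\<close>, hence are one-sided at the end points.\<close>

primrec ivl_deriv :: "real \<Rightarrow> real \<Rightarrow> nat \<Rightarrow> (real \<Rightarrow> 'a::real_normed_vector) \<Rightarrow> real \<Rightarrow> 'a" where
  "ivl_deriv a b 0 x = x"
| "ivl_deriv a b (Suc k) x = (\<lambda>t. vector_derivative (ivl_deriv a b k x) (at t within {a..b}))"

definition C_space :: "real \<Rightarrow> real \<Rightarrow> nat \<Rightarrow> (real \<Rightarrow> complex) set" where
  "C_space a b l = {x.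
     (\<forall>k<l. \<forall>t\<in>{a..b}. ivl_deriv a b k x differentiable (at t within {a..b})) \<and>
     (\<forall>k\<le>l. continuous_on {a..b} (ivl_deriv a b k x))}"

text \<open>For members of \<open>C_space a b l\<close> with \<open>a < b\<close> the suprema below are attained, i.e. are maxima.\<close>

definition C_norm :: "real \<Rightarrow> real \<Rightarrow> nat \<Rightarrow> (real \<Rightarrow> complex) \<Rightarrow> real" where
  "C_norm a b l x = (\<Sum>j=0..l. SUP t\<in>{a..b}. norm (ivl_deriv a b j x t))"

definition C_space_vec :: "real \<Rightarrow> real \<Rightarrow> nat \<Rightarrow> (real \<Rightarrow> complex^'m) set" where
  "C_space_vec a b l = {x. \<forall>i. (\<lambda>t. x t $ i) \<in> C_space a b l}"

definition C_norm_vec :: "real \<Rightarrow> real \<Rightarrow> nat \<Rightarrow> (real \<Rightarrow> complex^'m) \<Rightarrow> real" where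
  "C_norm_vec a b l x = (\<Sum>i\<in>UNIV. C_norm a b l (\<lambda>t. x t $ i))"

definition C_space_mat :: "real \<Rightarrow> real \<Rightarrow> nat \<Rightarrow> (real \<Rightarrow> complex^'m^'m) set" where
  "C_space_mat a b l = {x. \<forall>i j. (\<lambda>t. x t $ i $ j) \<in> C_space a b l}"

definition C_norm_mat :: "real \<Rightarrow> real \<Rightarrow> nat \<Rightarrow> (real \<Rightarrow> complex^'m^'m) \<Rightarrow> real" where
  "C_norm_mat a b l x = (\<Sum>i\<in>UNIV. \<Sum>j\<in>UNIV. C_norm a b l (\<lambda>t. x t $ i $ j))"

definition sum_norm :: "complex^'k \<Rightarrow> real" where
  "sum_norm v = (\<Sum>i\<in>UNIV. norm (v $ i))"

text \<open>The continuity clause makes the operator independent of the values of its argument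
  outside \<open>{a..b}\<close>, since \<open>C_norm_vec\<close> does not see them.\<close>

definition continuous_linear_op ::
    "real \<Rightarrow> real \<Rightarrow> nat \<Rightarrow> ((real \<Rightarrow> complex^'m) \<Rightarrow> complex^'k) \<Rightarrow> bool" where
  "continuous_linear_op a b l T \<longleftrightarrow>
     (\<forall>x\<in>C_space_vec a b l. \<forall>y\<in>C_space_vec a b l. T (\<lambda>t. x t + y t) = T x + T y) \<and>
     (\<forall>c. \<forall>x\<in>C_space_vec a b l. T (\<lambda>t. c *s x t) = c *s T x) \<and>
     (\<forall>x\<in>C_space_vec a b l. \<forall>e>0. \<exists>d>0. \<forall>y\<in>C_space_vec a b l.
        C_norm_vec a b l (\<lambda>t. y t - x t) < d \<longrightarrow> sum_norm (T y - T x) < e)"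

definition diff_op ::
    "real \<Rightarrow> real \<Rightarrow> nat \<Rightarrow> (nat \<Rightarrow> real \<Rightarrow> complex^'m^'m) \<Rightarrow> (real \<Rightarrow> complex^'m) \<Rightarrow> real \<Rightarrow> complex^'m" where
  "diff_op a b r K z = (\<lambda>t. ivl_deriv a b r z t + (\<Sum>j=1..r. K (r - j) t *v ivl_deriv a b (r - j) z t))"

definition bvp_solution ::
    "real \<Rightarrow> real \<Rightarrow> nat \<Rightarrow> nat \<Rightarrow> (nat \<Rightarrow> real \<Rightarrow> complex^'m^'m) \<Rightarrow> ((real \<Rightarrow> complex^'m) \<Rightarrow> complex^'k) \<Rightarrow>
     (real \<Rightarrow> complex^'m) \<Rightarrow> complex^'k \<Rightarrow> (real \<Rightarrow> complex^'m) \<Rightarrow> bool" where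
  "bvp_solution a b n r K B f q z \<longleftrightarrow>
     z \<in> C_space_vec a b (n + r) \<and> (\<forall>t\<in>{a..b}. diff_op a b r K z t = f t) \<and> B z = q"

end

theory Submission
  imports Defs "HOL-Complex_Analysis.Great_Picard"
begin

text \<open>
  Put \<open>w = z 0 - z \<epsilon>\<close>. Both quantities compared in the theorem depend only on \<open>w\<close>: since \<open>z \<epsilon>\<close>
  solves the problem with parameter \<open>\<epsilon>\<close>, the discrepancy is
  \<open>d = \<parallel>L(\<epsilon>) w\<parallel>\<^sub>n + \<parallel>B(\<epsilon>) w\<parallel>\<close>. So the claim is that the map \<open>w \<mapsto> (L(\<epsilon>) w, B(\<epsilon>) w)\<close> on
  \<open>C\<^sup>n\<^sup>+\<^sup>r\<close> is bounded and bounded below, with constants that do not depend on small \<open>\<epsilon>\<close>.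

  Boundedness. The coefficients are bounded in \<open>C\<^sup>n\<close> for small \<open>\<epsilon>\<close>, and the Leibniz rule makes
  \<open>C\<^sup>n\<close> an algebra up to the constant \<open>3\<^sup>n\<close> (\<open>C_norm_mult\<close>, \<open>diff_op_bound\<close>). The operators \<open>B(\<epsilon>)\<close>
  converge pointwise, hence are uniformly bounded by the Banach--Steinhaus principle
  (\<open>uniform_boundedness\<close>), which rests on completeness of \<open>C\<^sup>n\<^sup>+\<^sup>r\<close> (\<open>C_space_vec_complete\<close>).

  Boundedness below (\<open>uniform_inverse_bound\<close>). Otherwise there are \<open>\<epsilon>\<^sub>k\<close> tending to 0 and \<open>w\<^sub>k\<close> of norm 1
  with \<open>L(\<epsilon>\<^sub>k) w\<^sub>k\<close> and \<open>B(\<epsilon>\<^sub>k) w\<^sub>k\<close> tending to 0; then also \<open>L(0) w\<^sub>k\<close> tends to 0. By Arzela--Ascoli a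
  subsequence is Cauchy in \<open>C\<^sup>n\<^sup>+\<^sup>r\<^sup>-\<^sup>1\<close> (\<open>bounded_imp_Cauchy_subsequence\<close>). The equation expresses the
  top derivatives through \<open>L(0) w\<^sub>k\<close> and lower ones (\<open>diff_op_a_priori\<close>), so the subsequence is Cauchy
  even in \<open>C\<^sup>n\<^sup>+\<^sup>r\<close>. Its limit has norm 1 and solves the homogeneous limiting problem, contradicting
  the triviality of its solutions. This compactness argument replaces any use of a fundamental matrix.
\<close>

section \<open>The norm of absolute values and common subsequences\<close>

lemma sum_norm_triangle: "sum_norm (x + y) \<le> sum_norm x + sum_norm y"
  unfolding sum_norm_def sum.distrib[symmetric] by (intro sum_mono) (simp add: norm_triangle_ineq)

lemma sum_norm_triangle_diff: "sum_norm (x - y) \<le> sum_norm x + sum_norm y"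
  unfolding sum_norm_def sum.distrib[symmetric] by (intro sum_mono) (simp add: norm_triangle_ineq4)

lemma sum_norm_scale: "sum_norm (c *s x) = norm c * sum_norm x"
  by (simp add: sum_norm_def norm_mult sum_distrib_left)

lemma sum_norm_nonneg: "0 \<le> sum_norm x"
  unfolding sum_norm_def by (intro sum_nonneg) auto

lemma sum_norm_eq_0: "sum_norm x = 0 \<Longrightarrow> x = 0"
  by (simp add: sum_norm_def sum_nonneg_eq_0_iff vec_eq_iff)

lemma tendsto_sum_norm:
  assumes "(f \<longlongrightarrow> l) F"
  shows "((\<lambda>x. sum_norm (f x - l)) \<longlongrightarrow> 0) F"
proof -
  have "((\<lambda>x. sum_norm (f x - l)) \<longlongrightarrow> sum_norm (l - l)) F"
    unfolding sum_norm_def by (intro tendsto_intros assms)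
  then show ?thesis by (simp add: sum_norm_def)
qed

text \<open>Refining once for each of finitely many indices is enough because the property survives
  passage to a subsequence. Below, the indices are pairs of a component and an order of derivative.\<close>
lemma finite_common_subsequence:
  fixes P :: "'i \<Rightarrow> (nat \<Rightarrow> nat) \<Rightarrow> bool"
  assumes "finite I"
    and refine: "\<And>i s. i \<in> I \<Longrightarrow> strict_mono s \<Longrightarrow> \<exists>r::nat \<Rightarrow> nat. strict_mono r \<and> P i (s \<circ> r)"
    and hereditary: "\<And>i s (r::nat \<Rightarrow> nat). i \<in> I \<Longrightarrow> P i s \<Longrightarrow> strict_mono r \<Longrightarrow> P i (s \<circ> r)"
  shows "\<exists>s. strict_mono s \<and> (\<forall>i\<in>I. P i s)"
  using assms
proof (induction I rule: finite_induct)
  case empty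
  show ?case by (rule exI[of _ id]) (simp add: strict_mono_def)
next
  case (insert i I)
  then obtain s where s: "strict_mono s" "\<forall>i\<in>I. P i s" by auto
  obtain r where r: "strict_mono r" "P i (s \<circ> r)" using insert.prems(1)[OF insertI1 s(1)] by blast
  have "strict_mono (s \<circ> r)" by (rule strict_mono_o[OF s(1) r(1)])
  moreover have "P j (s \<circ> r)" if "j \<in> insert i I" for j
  proof (cases "j = i")
    case False
    then have "P j s" using s(2) that by auto
    then show ?thesis by (rule insert.prems(2)[OF that _ r(1)])
  qed (use r(2) in simp)
  ultimately show ?case by blast
qed

section \<open>Coefficient families and the lower-order part of the operator\<close>

text \<open>Membership of the coefficient family is packaged as a set, so that lemmas about \<open>diff_op\<close> have
  a first-order premise that determines \<open>K\<close> by unification.\<close>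
definition coeff_space :: "real \<Rightarrow> real \<Rightarrow> nat \<Rightarrow> nat \<Rightarrow> (nat \<Rightarrow> real \<Rightarrow> complex^'m^'m) set" where
  "coeff_space a b n r = {K. \<forall>j\<in>{1..r}. K (r - j) \<in> C_space_mat a b n}"

definition coeff_norm :: "real \<Rightarrow> real \<Rightarrow> nat \<Rightarrow> nat \<Rightarrow> (nat \<Rightarrow> real \<Rightarrow> complex^'m^'m) \<Rightarrow> real" where
  "coeff_norm a b n r K = (\<Sum>j=1..r. C_norm_mat a b n (K (r - j)))"

definition lower_part :: "real \<Rightarrow> real \<Rightarrow> nat \<Rightarrow> (nat \<Rightarrow> real \<Rightarrow> complex^'m^'m) \<Rightarrow>
    (real \<Rightarrow> complex^'m) \<Rightarrow> real \<Rightarrow> complex^'m" where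
  "lower_part a b r K z = (\<lambda>t. \<Sum>j=1..r. K (r - j) t *v ivl_deriv a b (r - j) z t)"

context
  fixes a b :: real
  assumes ab: "a < b"
begin

section \<open>Scalar functions with continuous derivatives\<close>

abbreviation sup_norm :: "(real \<Rightarrow> complex) \<Rightarrow> real" where
  "sup_norm x \<equiv> (SUP t\<in>{a..b}. norm (x t))"

text \<open>\<open>ivl_deriv\<close> is defined by choice of a derivative. All computations go through this uniqueness
  principle: any chain of successive derivatives on \<open>{a..b}\<close> is the chain of iterated derivatives.\<close>
lemma ivl_deriv_jet:
  fixes x :: "real \<Rightarrow> 'a::real_normed_vector"
  assumes "\<And>t. t \<in> {a..b} \<Longrightarrow> x t = D 0 t"
    and "\<And>k t. k < l \<Longrightarrow> t \<in> {a..b} \<Longrightarrow>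
      (D k has_vector_derivative D (Suc k) t) (at t within {a..b})"
    and "k \<le> l" "t \<in> {a..b}"
  shows "ivl_deriv a b k x t = D k t"
  using assms(3,4)
proof (induction k arbitrary: t)
  case 0
  then show ?case using assms(1) by simp
next
  case (Suc k)
  have "(D k has_vector_derivative D (Suc k) t) (at t within {a..b})"
    using assms(2) Suc.prems by auto
  then have "(ivl_deriv a b k x has_vector_derivative D (Suc k) t) (at t within {a..b})"
    by (rule has_vector_derivative_transform[rotated 2]) (use Suc in auto)
  then show ?case
    using vector_derivative_within_cbox[of a b t] ab Suc.prems by simp
qed

lemma C_spaceI_jet:
  assumes 1: "\<And>t. t \<in> {a..b} \<Longrightarrow> x t = D 0 t"
    and 2: "\<And>k t. k < l \<Longrightarrow> t \<in> {a..b} \<Longrightarrow>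
      (D k has_vector_derivative D (Suc k) t) (at t within {a..b})"
    and 3: "continuous_on {a..b} (D l)"
  shows "x \<in> C_space a b l"
proof -
  have eq: "ivl_deriv a b k x t = D k t" if "k \<le> l" "t \<in> {a..b}" for k t
    using ivl_deriv_jet[OF 1 2] that by blast
  have "ivl_deriv a b k x differentiable (at t within {a..b})" if "k < l" "t \<in> {a..b}" for k t
  proof -
    have "(ivl_deriv a b k x has_vector_derivative D (Suc k) t) (at t within {a..b})"
      by (rule has_vector_derivative_transform[OF _ _ 2]) (use that eq in auto)
    then show ?thesis by (rule differentiableI_vector)
  qed
  moreover have "continuous_on {a..b} (ivl_deriv a b k x)" if "k \<le> l" for k
  proof -
    have "continuous_on {a..b} (D k)"
    proof (cases "k = l")
      case False
      then have "k < l" using that by simp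
      then show ?thesis
        using 2 has_vector_derivative_continuous continuous_on_eq_continuous_within by blast
    qed (use 3 in simp)
    then show ?thesis using continuous_on_cong[of "{a..b}" "{a..b}" "ivl_deriv a b k x" "D k"] eq that by auto
  qed
  ultimately show ?thesis by (simp add: C_space_def)
qed

lemma C_space_has_derivative:
  assumes "x \<in> C_space a b l" "k < l" "t \<in> {a..b}"
  shows "(ivl_deriv a b k x has_vector_derivative ivl_deriv a b (Suc k) x t) (at t within {a..b})"
  using assms vector_derivative_works[of "ivl_deriv a b k x" "at t within {a..b}"]
  by (auto simp: C_space_def)

lemma C_space_continuous:
  "x \<in> C_space a b l \<Longrightarrow> k \<le> l \<Longrightarrow> continuous_on {a..b} (ivl_deriv a b k x)"
  by (simp add: C_space_def)

lemma C_space_mono: "x \<in> C_space a b l \<Longrightarrow> k \<le> l \<Longrightarrow> x \<in> C_space a b k"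
  by (simp add: C_space_def)

lemma ivl_deriv_cong:
  fixes x y :: "real \<Rightarrow> 'a::real_normed_vector"
  assumes "\<And>t. t \<in> {a..b} \<Longrightarrow> x t = y t" "t \<in> {a..b}"
  shows "ivl_deriv a b k x t = ivl_deriv a b k y t"
  using assms(2)
proof (induction k arbitrary: t)
  case (Suc k)
  have "(ivl_deriv a b k x has_vector_derivative d) (at t within {a..b}) \<longleftrightarrow>
     (ivl_deriv a b k y has_vector_derivative d) (at t within {a..b})" for d
    by (rule has_vector_derivative_cong_ev) (use Suc in auto)
  then show ?case by (simp add: vector_derivative_def)
qed (use assms in simp)

lemma C_space_cong:
  assumes "\<And>t. t \<in> {a..b} \<Longrightarrow> x t = y t" "y \<in> C_space a b l"
  shows "x \<in> C_space a b l"
  by (rule C_spaceI_jet[where D = "\<lambda>k. ivl_deriv a b k y"])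
    (use assms C_space_has_derivative C_space_continuous in auto)

lemma C_norm_cong:
  assumes "\<And>t. t \<in> {a..b} \<Longrightarrow> x t = y t"
  shows "C_norm a b l x = C_norm a b l y"
  unfolding C_norm_def using ivl_deriv_cong[OF assms] by (intro sum.cong SUP_cong) auto

lemma ivl_deriv_ivl_deriv: "ivl_deriv a b k (ivl_deriv a b p x) = ivl_deriv a b (k + p) x"
  by (induction k) auto

lemma C_space_ivl_deriv:
  assumes "x \<in> C_space a b l" "n + p \<le> l"
  shows "ivl_deriv a b p x \<in> C_space a b n"
  using assms by (auto simp: C_space_def ivl_deriv_ivl_deriv)

lemma sup_norm_upper:
  assumes "continuous_on {a..b} x" "t \<in> {a..b}"
  shows "norm (x t) \<le> sup_norm x"
proof (rule cSUP_upper)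
  have "compact ((\<lambda>t. norm (x t)) ` {a..b})"
    using assms by (intro compact_continuous_image continuous_intros) auto
  then show "bdd_above ((\<lambda>t. norm (x t)) ` {a..b})"
    by (intro bounded_imp_bdd_above compact_imp_bounded)
qed (use assms in auto)

lemma sup_norm_least: "(\<And>t. t \<in> {a..b} \<Longrightarrow> norm (x t) \<le> M) \<Longrightarrow> sup_norm x \<le> M"
  using ab by (intro cSUP_least) auto

lemma sup_norm_nonneg: "continuous_on {a..b} x \<Longrightarrow> 0 \<le> sup_norm x"
  using ab sup_norm_upper[of x a] norm_ge_zero[of "x a"] by (meson atLeastAtMost_iff less_imp_le order_refl order_trans)

lemma C_norm_alt: "C_norm a b l x = (\<Sum>j\<le>l. sup_norm (ivl_deriv a b j x))"
  by (simp add: C_norm_def atLeast0AtMost)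

lemma C_norm_nonneg: "x \<in> C_space a b l \<Longrightarrow> 0 \<le> C_norm a b l x"
  unfolding C_norm_alt by (intro sum_nonneg sup_norm_nonneg C_space_continuous) auto

lemma norm_ivl_deriv_le:
  assumes "x \<in> C_space a b l" "j \<le> l" "t \<in> {a..b}"
  shows "norm (ivl_deriv a b j x t) \<le> C_norm a b l x"
proof -
  have "norm (ivl_deriv a b j x t) \<le> sup_norm (ivl_deriv a b j x)"
    by (rule sup_norm_upper[OF C_space_continuous[OF assms(1,2)] assms(3)])
  also have "\<dots> \<le> C_norm a b l x"
    unfolding C_norm_alt
    by (intro member_le_sum sup_norm_nonneg C_space_continuous[OF assms(1)]) (use assms in auto)
  finally show ?thesis .
qed

lemma C_norm_le:
  assumes "\<And>j t. j \<le> l \<Longrightarrow> t \<in> {a..b} \<Longrightarrow> norm (ivl_deriv a b j x t) \<le> M"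
  shows "C_norm a b l x \<le> real (Suc l) * M"
proof -
  have "C_norm a b l x \<le> (\<Sum>j\<le>l. M)"
    unfolding C_norm_alt using assms by (intro sum_mono sup_norm_least) auto
  then show ?thesis by simp
qed

lemma C_norm_ivl_deriv_le:
  assumes "x \<in> C_space a b l" "n + p \<le> l"
  shows "C_norm a b n (ivl_deriv a b p x) \<le> C_norm a b l x"
proof -
  have "C_norm a b n (ivl_deriv a b p x) = (\<Sum>j\<in>{p..n+p}. sup_norm (ivl_deriv a b j x))"
    unfolding C_norm_alt ivl_deriv_ivl_deriv
    by (rule sum.reindex_bij_witness[of _ "\<lambda>i. i - p" "\<lambda>i. i + p"]) auto
  also have "\<dots> \<le> C_norm a b l x"
    unfolding C_norm_alt
    by (intro sum_mono2 sup_norm_nonneg C_space_continuous[OF assms(1)]) (use assms in auto)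
  finally show ?thesis .
qed

lemma C_norm_mono:
  assumes "x \<in> C_space a b l" "n \<le> l"
  shows "C_norm a b n x \<le> C_norm a b l x"
  using C_norm_ivl_deriv_le[of x l n 0] assms by simp

text \<open>The top derivative is the only summand of the larger norm that the smaller norm lacks, and it is
  also the top derivative of \<open>ivl_deriv a b (Suc n) x\<close>. This lets an equation for the highest
  derivative control the full norm.\<close>
lemma C_norm_Suc_le:
  "C_norm a b (Suc (p + n)) x \<le> C_norm a b (p + n) x + C_norm a b p (ivl_deriv a b (Suc n) x)"
  if "x \<in> C_space a b (Suc (p + n))"
proof -
  have "sup_norm (ivl_deriv a b p (ivl_deriv a b (Suc n) x)) \<le> C_norm a b p (ivl_deriv a b (Suc n) x)"
    unfolding C_norm_alt
    by (rule member_le_sum)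
      (auto intro!: sup_norm_nonneg C_space_continuous[OF C_space_ivl_deriv[OF that]] simp del: ivl_deriv.simps)
  then show ?thesis
    unfolding C_norm_alt ivl_deriv_ivl_deriv by (simp del: ivl_deriv.simps)
qed

lemma
  assumes "x \<in> C_space a b l" "y \<in> C_space a b l"
  shows C_space_add: "(\<lambda>t. x t + y t) \<in> C_space a b l"
    and ivl_deriv_add: "\<And>k t. k \<le> l \<Longrightarrow> t \<in> {a..b} \<Longrightarrow>
      ivl_deriv a b k (\<lambda>t. x t + y t) t = ivl_deriv a b k x t + ivl_deriv a b k y t"
    and C_norm_triangle: "C_norm a b l (\<lambda>t. x t + y t) \<le> C_norm a b l x + C_norm a b l y"
proof -
  let ?D = "\<lambda>k t. ivl_deriv a b k x t + ivl_deriv a b k y t"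
  have d: "(?D k has_vector_derivative ?D (Suc k) t) (at t within {a..b})"
    if "k < l" "t \<in> {a..b}" for k t
    using that assms by (intro derivative_intros C_space_has_derivative) auto
  show "(\<lambda>t. x t + y t) \<in> C_space a b l"
    by (rule C_spaceI_jet[where D = ?D, OF _ d])
      (use assms C_space_continuous in \<open>auto intro!: continuous_intros\<close>)
  show eq: "ivl_deriv a b k (\<lambda>t. x t + y t) t = ?D k t" if "k \<le> l" "t \<in> {a..b}" for k t
    by (rule ivl_deriv_jet[where D = ?D, OF _ d]) (use that in auto)
  have "sup_norm (ivl_deriv a b k (\<lambda>t. x t + y t))
      \<le> sup_norm (ivl_deriv a b k x) + sup_norm (ivl_deriv a b k y)" if "k \<le> l" for k
  proof (rule sup_norm_least)
    fix t assume t: "t \<in> {a..b}"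
    have "norm (?D k t) \<le> norm (ivl_deriv a b k x t) + norm (ivl_deriv a b k y t)"
      by (rule norm_triangle_ineq)
    also have "\<dots> \<le> sup_norm (ivl_deriv a b k x) + sup_norm (ivl_deriv a b k y)"
      by (intro add_mono sup_norm_upper C_space_continuous[OF assms(1)]
        C_space_continuous[OF assms(2)] that t)
    finally show "norm (ivl_deriv a b k (\<lambda>t. x t + y t) t) \<le> \<dots>"
      using eq that t by simp
  qed
  then show "C_norm a b l (\<lambda>t. x t + y t) \<le> C_norm a b l x + C_norm a b l y"
    unfolding C_norm_alt sum.distrib[symmetric] by (intro sum_mono) auto
qed

lemma
  assumes "x \<in> C_space a b l"
  shows C_space_scale: "(\<lambda>t. c * x t) \<in> C_space a b l"
    and ivl_deriv_scale: "\<And>k t. k \<le> l \<Longrightarrow> t \<in> {a..b} \<Longrightarrow>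
      ivl_deriv a b k (\<lambda>t. c * x t) t = c * ivl_deriv a b k x t"
proof -
  let ?D = "\<lambda>k t. c * ivl_deriv a b k x t"
  have d: "(?D k has_vector_derivative ?D (Suc k) t) (at t within {a..b})"
    if "k < l" "t \<in> {a..b}" for k t
    using that assms by (intro has_vector_derivative_mult_right C_space_has_derivative) auto
  show "(\<lambda>t. c * x t) \<in> C_space a b l"
    by (rule C_spaceI_jet[where D = ?D, OF _ d])
      (use assms C_space_continuous in \<open>auto intro!: continuous_intros\<close>)
  show "ivl_deriv a b k (\<lambda>t. c * x t) t = ?D k t" if "k \<le> l" "t \<in> {a..b}" for k t
    by (rule ivl_deriv_jet[where D = ?D, OF _ d]) (use that in auto)
qed

lemma C_norm_scale:
  assumes "x \<in> C_space a b l"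
  shows "C_norm a b l (\<lambda>t. c * x t) = norm c * C_norm a b l x"
proof -
  have le: "C_norm a b l (\<lambda>t. c * x t) \<le> norm c * C_norm a b l x"
    if x: "x \<in> C_space a b l" for c x
  proof -
    have "sup_norm (ivl_deriv a b k (\<lambda>t. c * x t)) \<le> norm c * sup_norm (ivl_deriv a b k x)"
      if "k \<le> l" for k
      by (rule sup_norm_least)
        (use sup_norm_upper[OF C_space_continuous[OF x that]] ivl_deriv_scale[OF x that]
          in \<open>auto simp: norm_mult intro!: mult_left_mono\<close>)
    then show ?thesis
      unfolding C_norm_alt sum_distrib_left by (intro sum_mono) auto
  qed
  show ?thesis
  proof (cases "c = 0")
    case True
    then show ?thesis using le[OF assms, of c] C_norm_nonneg[OF C_space_scale[OF assms], of c] by simp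
  next
    case False
    have "C_norm a b l x = C_norm a b l (\<lambda>t. inverse c * (c * x t))"
      using False by (simp add: mult.assoc[symmetric])
    also have "\<dots> \<le> inverse (norm c) * C_norm a b l (\<lambda>t. c * x t)"
      using le[OF C_space_scale[OF assms], of "inverse c"] by (simp add: norm_inverse)
    finally show ?thesis using le[OF assms, of c] False
      by (simp add: field_simps)
  qed
qed

lemma C_space_zero: "(\<lambda>t. 0) \<in> C_space a b l"
  by (rule C_spaceI_jet[where D = "\<lambda>k t. 0"]) auto

lemma C_norm_zero: "C_norm a b l (\<lambda>t. 0) = 0"
  using C_norm_scale[OF C_space_zero, of l 0] by simp

lemma
  assumes "\<And>i. i \<in> I \<Longrightarrow> x i \<in> C_space a b l"
  shows C_space_sum: "(\<lambda>t. \<Sum>i\<in>I. x i t) \<in> C_space a b l"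
    and C_norm_sum: "C_norm a b l (\<lambda>t. \<Sum>i\<in>I. x i t) \<le> (\<Sum>i\<in>I. C_norm a b l (x i))"
proof -
  have "(\<lambda>t. \<Sum>i\<in>I. x i t) \<in> C_space a b l
    \<and> C_norm a b l (\<lambda>t. \<Sum>i\<in>I. x i t) \<le> (\<Sum>i\<in>I. C_norm a b l (x i))"
    using assms
  proof (induction I rule: infinite_finite_induct)
    case (insert i I)
    then show ?case
      using C_space_add[of "x i" l "\<lambda>t. \<Sum>i\<in>I. x i t"]
        C_norm_triangle[of "x i" l "\<lambda>t. \<Sum>i\<in>I. x i t"] by fastforce
  qed (auto simp: C_space_zero C_norm_zero)
  then show "(\<lambda>t. \<Sum>i\<in>I. x i t) \<in> C_space a b l"
    "C_norm a b l (\<lambda>t. \<Sum>i\<in>I. x i t) \<le> (\<Sum>i\<in>I. C_norm a b l (x i))" by auto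
qed

text \<open>Peeling off the lowest derivative, for induction on the order.\<close>
lemma
  assumes "\<And>t. t \<in> {a..b} \<Longrightarrow> (x has_vector_derivative x' t) (at t within {a..b})"
    and "x' \<in> C_space a b l"
  shows C_space_SucI: "x \<in> C_space a b (Suc l)"
    and C_norm_Suc: "C_norm a b (Suc l) x = sup_norm x + C_norm a b l x'"
proof -
  let ?D = "\<lambda>k. case k of 0 \<Rightarrow> x | Suc k \<Rightarrow> ivl_deriv a b k x'"
  have d: "(?D k has_vector_derivative ?D (Suc k) t) (at t within {a..b})"
    if "k < Suc l" "t \<in> {a..b}" for k t
  proof (cases k)
    case 0
    then show ?thesis using assms(1) that by simp
  next
    case (Suc k')
    then show ?thesis using C_space_has_derivative[OF assms(2), of k' t] that by simp
  qed
  show "x \<in> C_space a b (Suc l)"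
    by (rule C_spaceI_jet[where D = ?D, OF _ d])
      (use assms C_space_continuous in auto)
  have "ivl_deriv a b (Suc k) x t = ?D (Suc k) t" if "k \<le> l" "t \<in> {a..b}" for k t
    by (rule ivl_deriv_jet[where D = ?D, OF _ d]) (use that in auto)
  then have "sup_norm (ivl_deriv a b (Suc k) x) = sup_norm (ivl_deriv a b k x')" if "k \<le> l" for k
    using that by (intro SUP_cong) auto
  then show "C_norm a b (Suc l) x = sup_norm x + C_norm a b l x'"
    unfolding C_norm_alt by (subst sum.atMost_Suc_shift) (simp del: ivl_deriv.simps(2))
qed

text \<open>Induction on the order by \<open>(x y)' = x y' + x' y\<close>. Each step produces one undifferentiated product
  and two products of lower order, whence a factor 3.\<close>
lemma
  assumes "x \<in> C_space a b l" "y \<in> C_space a b l"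
  shows C_space_mult: "(\<lambda>t. x t * y t) \<in> C_space a b l"
    and C_norm_mult: "C_norm a b l (\<lambda>t. x t * y t) \<le> 3 ^ l * (C_norm a b l x * C_norm a b l y)"
proof -
  have sup_mult: "sup_norm (\<lambda>t. x t * y t) \<le> sup_norm x * sup_norm y"
    if "continuous_on {a..b} x" "continuous_on {a..b} y" for x y
    by (rule sup_norm_least)
      (use that in \<open>auto simp: norm_mult intro!: mult_mono sup_norm_upper sup_norm_nonneg\<close>)
  have "(\<lambda>t. x t * y t) \<in> C_space a b l \<and>
    C_norm a b l (\<lambda>t. x t * y t) \<le> 3 ^ l * (C_norm a b l x * C_norm a b l y)"
    using assms
  proof (induction l arbitrary: x y)
    case 0
    have "continuous_on {a..b} x" "continuous_on {a..b} y"
      using C_space_continuous[of _ 0 0] 0 by auto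
    then show ?case using sup_mult[of x y]
      by (auto simp: C_space_def C_norm_alt intro!: continuous_intros)
  next
    case (Suc l)
    define x' y' where "x' = ivl_deriv a b 1 x" and "y' = ivl_deriv a b 1 y"
    have c: "continuous_on {a..b} x" "continuous_on {a..b} y"
      using C_space_continuous[of _ "Suc l" 0] Suc.prems by auto
    have sp: "x \<in> C_space a b l" "y \<in> C_space a b l" "x' \<in> C_space a b l" "y' \<in> C_space a b l"
      using Suc.prems C_space_mono[of _ "Suc l" l] C_space_ivl_deriv[of _ "Suc l" l 1]
      unfolding x'_def y'_def by auto
    have dx: "(x has_vector_derivative x' t) (at t within {a..b})"
      and dy: "(y has_vector_derivative y' t) (at t within {a..b})" if "t \<in> {a..b}" for t
      using C_space_has_derivative[OF _ _ that, of _ "Suc l" 0] Suc.prems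
      unfolding x'_def y'_def by auto
    let ?d = "\<lambda>t. x t * y' t + x' t * y t"
    have d: "((\<lambda>t. x t * y t) has_vector_derivative ?d t) (at t within {a..b})"
      if "t \<in> {a..b}" for t
      using dx[OF that] dy[OF that] by (rule has_vector_derivative_mult)
    have sp': "?d \<in> C_space a b l"
      using Suc.IH sp by (intro C_space_add) auto
    have nx: "C_norm a b (Suc l) x = sup_norm x + C_norm a b l x'"
      and ny: "C_norm a b (Suc l) y = sup_norm y + C_norm a b l y'"
      using C_norm_Suc[OF dx sp(3)] C_norm_Suc[OF dy sp(4)] by auto
    have n: "C_norm a b l x' \<le> C_norm a b (Suc l) x" "C_norm a b l y' \<le> C_norm a b (Suc l) y"
      "C_norm a b l x \<le> C_norm a b (Suc l) x" "C_norm a b l y \<le> C_norm a b (Suc l) y"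
      using nx ny sup_norm_nonneg c C_norm_mono[OF Suc.prems(1)] C_norm_mono[OF Suc.prems(2)] by auto
    have s: "sup_norm x \<le> C_norm a b (Suc l) x" "sup_norm y \<le> C_norm a b (Suc l) y"
      using nx ny C_norm_nonneg sp by auto
    let ?P = "C_norm a b (Suc l) x * C_norm a b (Suc l) y"
    have "0 \<le> C_norm a b (Suc l) x" "0 \<le> C_norm a b (Suc l) y"
      using C_norm_nonneg Suc.prems by auto
    note nn = this
    have "C_norm a b (Suc l) (\<lambda>t. x t * y t) = sup_norm (\<lambda>t. x t * y t) + C_norm a b l ?d"
      using C_norm_Suc[OF d sp'] by simp
    also have "\<dots> \<le> sup_norm x * sup_norm y +
        (C_norm a b l (\<lambda>t. x t * y' t) + C_norm a b l (\<lambda>t. x' t * y t))"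
      using Suc.IH sp by (intro add_mono sup_mult c C_norm_triangle) auto
    also have "\<dots> \<le> ?P + (3 ^ l * ?P + 3 ^ l * ?P)"
    proof (intro add_mono)
      show "sup_norm x * sup_norm y \<le> ?P"
        using s nn sup_norm_nonneg c by (intro mult_mono) auto
      have "C_norm a b l (\<lambda>t. x t * y' t) \<le> 3 ^ l * (C_norm a b l x * C_norm a b l y')"
        using Suc.IH sp by auto
      also have "\<dots> \<le> 3 ^ l * ?P"
        using n nn sp Suc.prems by (intro mult_left_mono mult_mono C_norm_nonneg) auto
      finally show "C_norm a b l (\<lambda>t. x t * y' t) \<le> 3 ^ l * ?P" .
      have "C_norm a b l (\<lambda>t. x' t * y t) \<le> 3 ^ l * (C_norm a b l x' * C_norm a b l y)"
        using Suc.IH sp by auto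
      also have "\<dots> \<le> 3 ^ l * ?P"
        using n nn sp Suc.prems by (intro mult_left_mono mult_mono C_norm_nonneg) auto
      finally show "C_norm a b l (\<lambda>t. x' t * y t) \<le> 3 ^ l * ?P" .
    qed
    also have "\<dots> \<le> 3 ^ Suc l * ?P"
    proof -
      have "1 * ?P \<le> 3 ^ l * ?P" using nn by (intro mult_right_mono) auto
      then show ?thesis by simp
    qed
    finally show ?case using C_space_SucI[OF d sp'] by auto
  qed
  then show "(\<lambda>t. x t * y t) \<in> C_space a b l"
    "C_norm a b l (\<lambda>t. x t * y t) \<le> 3 ^ l * (C_norm a b l x * C_norm a b l y)" by auto
qed


lemma
  assumes "x \<in> C_space a b l" "y \<in> C_space a b l"
  shows C_space_diff: "(\<lambda>t. x t - y t) \<in> C_space a b l"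
    and ivl_deriv_diff: "\<And>k t. k \<le> l \<Longrightarrow> t \<in> {a..b} \<Longrightarrow>
      ivl_deriv a b k (\<lambda>t. x t - y t) t = ivl_deriv a b k x t - ivl_deriv a b k y t"
proof -
  show "(\<lambda>t. x t - y t) \<in> C_space a b l"
    using C_space_add[OF assms(1) C_space_scale[OF assms(2), of "-1"]] by simp
  show "ivl_deriv a b k (\<lambda>t. x t - y t) t = ivl_deriv a b k x t - ivl_deriv a b k y t"
    if "k \<le> l" "t \<in> {a..b}" for k t
    using ivl_deriv_add[OF assms(1) C_space_scale[OF assms(2), of "-1"] that]
      ivl_deriv_scale[OF assms(2) that, of "-1"] by simp
qed

text \<open>The derivatives of each order converge uniformly, and a uniform limit of derivatives is the
  derivative of the limit, so the limits form a chain as required by \<open>C_spaceI_jet\<close>.\<close>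
lemma C_space_complete:
  assumes x: "\<And>k. x k \<in> C_space a b l"
    and cauchy: "\<And>e. e > 0 \<Longrightarrow> \<exists>M. \<forall>m\<ge>M. \<forall>p\<ge>M. C_norm a b l (\<lambda>t. x m t - x p t) < e"
  shows "\<exists>g\<in>C_space a b l. (\<lambda>k. C_norm a b l (\<lambda>t. x k t - g t)) \<longlonglongrightarrow> 0"
proof -
  have "uniformly_Cauchy_on {a..b} (\<lambda>k. ivl_deriv a b j (x k))" if "j \<le> l" for j
    unfolding uniformly_Cauchy_on_def
  proof (intro allI impI)
    fix e :: real assume "e > 0"
    then obtain M where M: "\<forall>m\<ge>M. \<forall>p\<ge>M. C_norm a b l (\<lambda>t. x m t - x p t) < e"
      using cauchy by blast
    have "dist (ivl_deriv a b j (x m) t) (ivl_deriv a b j (x p) t) < e"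
      if "t \<in> {a..b}" "m \<ge> M" "p \<ge> M" for m p t
    proof -
      have "dist (ivl_deriv a b j (x m) t) (ivl_deriv a b j (x p) t)
          = norm (ivl_deriv a b j (\<lambda>t. x m t - x p t) t)"
        using ivl_deriv_diff[OF x x \<open>j \<le> l\<close> \<open>t \<in> {a..b}\<close>] by (simp add: dist_norm)
      also have "\<dots> \<le> C_norm a b l (\<lambda>t. x m t - x p t)"
        by (rule norm_ivl_deriv_le[OF C_space_diff[OF x x]]) (use that \<open>j \<le> l\<close> in auto)
      also have "\<dots> < e" using M that by auto
      finally show ?thesis .
    qed
    then show "\<exists>M. \<forall>t\<in>{a..b}. \<forall>m\<ge>M. \<forall>p\<ge>M. dist (ivl_deriv a b j (x m) t) (ivl_deriv a b j (x p) t) < e"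
      by blast
  qed
  then have "\<exists>g. uniform_limit {a..b} (\<lambda>k. ivl_deriv a b j (x k)) g sequentially" if "j \<le> l" for j
    using Cauchy_uniformly_convergent that unfolding uniformly_convergent_on_def by blast
  then obtain G where G: "\<And>j. j \<le> l \<Longrightarrow>
      uniform_limit {a..b} (\<lambda>k. ivl_deriv a b j (x k)) (G j) sequentially"
    by metis
  have lim: "(\<lambda>k. ivl_deriv a b j (x k) t) \<longlonglongrightarrow> G j t" if "j \<le> l" "t \<in> {a..b}" for j t
    using tendsto_uniform_limitI[OF G] that by blast
  have d: "(G j has_vector_derivative G (Suc j) t) (at t within {a..b})"
    if j: "j < l" and t: "t \<in> {a..b}" for j t
  proof -
    have "\<exists>g. \<forall>t\<in>{a..b}. (\<lambda>k. ivl_deriv a b j (x k) t) \<longlonglongrightarrow> g t \<and>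
        (g has_derivative (\<lambda>h. h *\<^sub>R G (Suc j) t)) (at t within {a..b})"
    proof (rule has_derivative_sequence)
      show "(ivl_deriv a b j (x k) has_derivative (\<lambda>h. h *\<^sub>R ivl_deriv a b (Suc j) (x k) t))
          (at t within {a..b})" if "t \<in> {a..b}" for k t
        using C_space_has_derivative[OF x j that] by (simp add: has_vector_derivative_def)
      show "\<forall>\<^sub>F k in sequentially. \<forall>t\<in>{a..b}. \<forall>h.
          norm (h *\<^sub>R ivl_deriv a b (Suc j) (x k) t - h *\<^sub>R G (Suc j) t) \<le> e * norm h"
        if "e > 0" for e
        using uniform_limitD[OF G[of "Suc j"] \<open>e > 0\<close>] j
      proof (simp del: ivl_deriv.simps, elim eventually_mono)
        fix k assume *: "\<forall>t\<in>{a..b}. dist (ivl_deriv a b (Suc j) (x k) t) (G (Suc j) t) < e"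
        show "\<forall>t\<in>{a..b}. \<forall>h. cmod (h *\<^sub>R ivl_deriv a b (Suc j) (x k) t - h *\<^sub>R G (Suc j) t) \<le> e * \<bar>h\<bar>"
        proof (intro ballI allI)
          fix t h assume "t \<in> {a..b}"
          then have "norm (ivl_deriv a b (Suc j) (x k) t - G (Suc j) t) \<le> e"
            using * by (auto simp: dist_norm simp del: ivl_deriv.simps intro: less_imp_le)
          then have "\<bar>h\<bar> * norm (ivl_deriv a b (Suc j) (x k) t - G (Suc j) t) \<le> \<bar>h\<bar> * e"
            by (rule mult_left_mono) auto
          then show "cmod (h *\<^sub>R ivl_deriv a b (Suc j) (x k) t - h *\<^sub>R G (Suc j) t) \<le> e * \<bar>h\<bar>"
            by (simp add: scaleR_diff_right[symmetric] mult.commute del: ivl_deriv.simps scaleR_diff_right)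
        qed
      qed
      show "(\<lambda>k. ivl_deriv a b j (x k) a) \<longlonglongrightarrow> G j a" using lim j ab by auto
    qed (use ab in auto)
    then obtain g where g: "\<And>t. t \<in> {a..b} \<Longrightarrow> (\<lambda>k. ivl_deriv a b j (x k) t) \<longlonglongrightarrow> g t"
      "\<And>t. t \<in> {a..b} \<Longrightarrow> (g has_vector_derivative G (Suc j) t) (at t within {a..b})"
      unfolding has_vector_derivative_def by blast
    have "G j t = g t" if "t \<in> {a..b}" for t
      using LIMSEQ_unique[OF lim g(1)] that j by auto
    then show ?thesis
      using has_vector_derivative_transform[OF t _ g(2)[OF t], of "G j"] by blast
  qed
  have sp: "G 0 \<in> C_space a b l"
  proof (rule C_spaceI_jet[where D = G, OF _ d])
    show "continuous_on {a..b} (G l)"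
      by (rule uniform_limit_theorem[OF _ G]) (use C_space_continuous[OF x] in auto)
  qed auto
  have eq: "ivl_deriv a b j (G 0) t = G j t" if "j \<le> l" "t \<in> {a..b}" for j t
    by (rule ivl_deriv_jet[where D = G, OF _ d]) (use that in auto)
  have "(\<lambda>k. C_norm a b l (\<lambda>t. x k t - G 0 t)) \<longlonglongrightarrow> 0"
  proof (rule tendstoI)
    fix e :: real assume "e > 0"
    define d where "d = e / (2 * real (Suc l))"
    have "d > 0" using \<open>e > 0\<close> by (simp add: d_def)
    have "\<forall>\<^sub>F k in sequentially. \<forall>j\<in>{..l}. \<forall>t\<in>{a..b}. dist (ivl_deriv a b j (x k) t) (G j t) < d"
      by (rule eventually_ball_finite) (use uniform_limitD[OF G \<open>d > 0\<close>] in auto)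
    then show "\<forall>\<^sub>F k in sequentially. dist (C_norm a b l (\<lambda>t. x k t - G 0 t)) 0 < e"
    proof (rule eventually_mono)
      fix k assume *: "\<forall>j\<in>{..l}. \<forall>t\<in>{a..b}. dist (ivl_deriv a b j (x k) t) (G j t) < d"
      have "C_norm a b l (\<lambda>t. x k t - G 0 t) \<le> real (Suc l) * d"
      proof (rule C_norm_le)
        fix j t assume j: "j \<le> l" and t: "t \<in> {a..b}"
        then have "dist (ivl_deriv a b j (x k) t) (G j t) \<le> d"
          using * by (auto intro: less_imp_le)
        then show "norm (ivl_deriv a b j (\<lambda>t. x k t - G 0 t) t) \<le> d"
          using ivl_deriv_diff[OF x sp j t] eq[OF j t] by (simp add: dist_norm)
      qed
      also have "real (Suc l) * d = e / 2" by (simp add: d_def field_simps del: of_nat_Suc)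
      also have "e / 2 < e" using \<open>e > 0\<close> by simp
      finally have "C_norm a b l (\<lambda>t. x k t - G 0 t) < e" .
      then show "dist (C_norm a b l (\<lambda>t. x k t - G 0 t)) 0 < e"
        using C_norm_nonneg[OF C_space_diff[OF x[of k] sp]] by simp
    qed
  qed
  then show ?thesis using sp by blast
qed

section \<open>Vector-valued functions\<close>

text \<open>The spaces and norms are defined componentwise but \<open>diff_op\<close> differentiates the vector function;
  this connects the two.\<close>
lemma ivl_deriv_component:
  fixes z :: "real \<Rightarrow> complex^'m"
  assumes z: "z \<in> C_space_vec a b l" and "k \<le> l" "t \<in> {a..b}"
  shows "ivl_deriv a b k z t $ i = ivl_deriv a b k (\<lambda>t. z t $ i) t"
proof -
  let ?D = "\<lambda>k t. \<chi> i. ivl_deriv a b k (\<lambda>t. z t $ i) t"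
  have "(?D k has_vector_derivative ?D (Suc k) t) (at t within {a..b})"
    if "k < l" "t \<in> {a..b}" for k t
  proof -
    have "((\<lambda>s. ivl_deriv a b k (\<lambda>t. z t $ i) s) has_vector_derivative
        ivl_deriv a b (Suc k) (\<lambda>t. z t $ i) t) (at t within {a..b})" for i
      using C_space_has_derivative[OF _ that] z by (auto simp: C_space_vec_def)
    then show ?thesis
      unfolding has_vector_derivative_def has_derivative_within
      by (auto intro!: vec_tendstoI bounded_linear_scaleR_left simp del: ivl_deriv.simps)
  qed
  then have "ivl_deriv a b k z t = ?D k t"
    using assms by (intro ivl_deriv_jet[where D = ?D]) (auto simp: vec_eq_iff)
  then show ?thesis by simp
qed

lemma C_space_vecD: "z \<in> C_space_vec a b l \<Longrightarrow> (\<lambda>t. z t $ i) \<in> C_space a b l"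
  by (simp add: C_space_vec_def)

lemma C_norm_vec_cong:
  assumes "\<And>t. t \<in> {a..b} \<Longrightarrow> x t = y t"
  shows "C_norm_vec a b l x = C_norm_vec a b l y"
  unfolding C_norm_vec_def
  using assms by (intro sum.cong C_norm_cong) auto

lemma C_norm_vec_nonneg: "x \<in> C_space_vec a b l \<Longrightarrow> 0 \<le> C_norm_vec a b l x"
  unfolding C_norm_vec_def by (intro sum_nonneg C_norm_nonneg C_space_vecD)

lemma C_norm_component_le:
  assumes "x \<in> C_space_vec a b l"
  shows "C_norm a b l (\<lambda>t. x t $ i) \<le> C_norm_vec a b l x"
  unfolding C_norm_vec_def
  by (rule member_le_sum[of i UNIV "\<lambda>i. C_norm a b l (\<lambda>t. x t $ i)"])
    (use assms C_norm_nonneg[OF C_space_vecD] in auto)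

lemma C_space_vec_add:
  "x \<in> C_space_vec a b l \<Longrightarrow> y \<in> C_space_vec a b l \<Longrightarrow> (\<lambda>t. x t + y t) \<in> C_space_vec a b l"
  by (simp add: C_space_vec_def C_space_add)

lemma C_space_vec_diff:
  "x \<in> C_space_vec a b l \<Longrightarrow> y \<in> C_space_vec a b l \<Longrightarrow> (\<lambda>t. x t - y t) \<in> C_space_vec a b l"
  by (simp add: C_space_vec_def C_space_diff)

lemma C_space_vec_scale: "x \<in> C_space_vec a b l \<Longrightarrow> (\<lambda>t. c *s x t) \<in> C_space_vec a b l"
  by (simp add: C_space_vec_def C_space_scale)

lemma C_space_vec_sum:
  "(\<And>i. i \<in> I \<Longrightarrow> x i \<in> C_space_vec a b l) \<Longrightarrow> (\<lambda>t. \<Sum>i\<in>I. x i t) \<in> C_space_vec a b l"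
  by (simp add: C_space_vec_def C_space_sum)

lemma C_norm_vec_scale:
  assumes "x \<in> C_space_vec a b l"
  shows "C_norm_vec a b l (\<lambda>t. c *s x t) = norm c * C_norm_vec a b l x"
  using assms by (simp add: C_norm_vec_def C_norm_scale[OF C_space_vecD] sum_distrib_left)

lemma C_norm_vec_zero: "C_norm_vec a b l (\<lambda>t. 0) = 0"
  by (simp add: C_norm_vec_def C_norm_zero)

lemma C_norm_vec_triangle:
  assumes "x \<in> C_space_vec a b l" "y \<in> C_space_vec a b l"
  shows "C_norm_vec a b l (\<lambda>t. x t + y t) \<le> C_norm_vec a b l x + C_norm_vec a b l y"
  unfolding C_norm_vec_def sum.distrib[symmetric] vector_add_component
  using assms by (intro sum_mono C_norm_triangle C_space_vecD)

lemma C_norm_vec_sum: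
  assumes "\<And>i. i \<in> I \<Longrightarrow> x i \<in> C_space_vec a b l"
  shows "C_norm_vec a b l (\<lambda>t. \<Sum>i\<in>I. x i t) \<le> (\<Sum>i\<in>I. C_norm_vec a b l (x i))"
  unfolding C_norm_vec_def sum_component
  by (subst sum.swap) (intro sum_mono C_norm_sum C_space_vecD assms)

lemma
  assumes "x \<in> C_space_vec a b l" "y \<in> C_space_vec a b l"
  shows C_norm_vec_minus_commute: "C_norm_vec a b l (\<lambda>t. x t - y t) = C_norm_vec a b l (\<lambda>t. y t - x t)"
    and C_norm_vec_triangle_diff: "C_norm_vec a b l (\<lambda>t. x t - y t) \<le> C_norm_vec a b l x + C_norm_vec a b l y"
proof -
  have "(\<lambda>t. x t - y t) = (\<lambda>t. (-1) *s (y t - x t))"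
    by (simp add: vec_eq_iff fun_eq_iff)
  then show "C_norm_vec a b l (\<lambda>t. x t - y t) = C_norm_vec a b l (\<lambda>t. y t - x t)"
    using C_norm_vec_scale[OF C_space_vec_diff[OF assms(2,1)], of "-1"] by simp
  have "(\<lambda>t. x t - y t) = (\<lambda>t. x t + (-1) *s y t)"
    by (simp add: vec_eq_iff fun_eq_iff)
  then show "C_norm_vec a b l (\<lambda>t. x t - y t) \<le> C_norm_vec a b l x + C_norm_vec a b l y"
    using C_norm_vec_triangle[OF assms(1) C_space_vec_scale[OF assms(2), of "-1"]]
      C_norm_vec_scale[OF assms(2), of "-1"] by simp
qed

lemma norm_component_le_C_norm_vec:
  assumes "x \<in> C_space_vec a b l" "t \<in> {a..b}"
  shows "norm (x t $ i) \<le> C_norm_vec a b l x"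
  using norm_ivl_deriv_le[OF C_space_vecD[OF assms(1), of i], of 0 t] assms
    C_norm_component_le[OF assms(1), of i] by simp

lemma
  assumes A: "A \<in> C_space_mat a b l" and x: "x \<in> C_space_vec a b l"
  shows C_space_mat_vec_mult: "(\<lambda>t. A t *v x t) \<in> C_space_vec a b l"
    and C_norm_mat_vec_mult:
      "C_norm_vec a b l (\<lambda>t. A t *v x t) \<le> 3 ^ l * (C_norm_mat a b l A * C_norm_vec a b l x)"
proof -
  have A': "(\<lambda>t. A t $ i $ j) \<in> C_space a b l" for i j
    using A by (simp add: C_space_mat_def)
  note m = C_space_mult[OF A' C_space_vecD[OF x]]
  show "(\<lambda>t. A t *v x t) \<in> C_space_vec a b l"
    unfolding C_space_vec_def matrix_vector_mult_def
    by (auto intro: C_space_sum m)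
  have "C_norm_vec a b l (\<lambda>t. A t *v x t)
      = (\<Sum>i\<in>UNIV. C_norm a b l (\<lambda>t. \<Sum>j\<in>UNIV. A t $ i $ j * x t $ j))"
    by (simp add: C_norm_vec_def matrix_vector_mult_def)
  also have "\<dots> \<le> (\<Sum>i\<in>UNIV. \<Sum>j\<in>UNIV. 3 ^ l * (C_norm a b l (\<lambda>t. A t $ i $ j) * C_norm_vec a b l x))"
  proof (rule sum_mono)
    fix i
    have "C_norm a b l (\<lambda>t. \<Sum>j\<in>UNIV. A t $ i $ j * x t $ j)
      \<le> (\<Sum>j\<in>UNIV. C_norm a b l (\<lambda>t. A t $ i $ j * x t $ j))"
      by (rule C_norm_sum[OF m])
    also have "\<dots> \<le> (\<Sum>j\<in>UNIV. 3 ^ l * (C_norm a b l (\<lambda>t. A t $ i $ j) * C_norm_vec a b l x))"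
    proof (rule sum_mono)
      fix j
      have "C_norm a b l (\<lambda>t. A t $ i $ j * x t $ j)
        \<le> 3 ^ l * (C_norm a b l (\<lambda>t. A t $ i $ j) * C_norm a b l (\<lambda>t. x t $ j))"
        by (rule C_norm_mult[OF A' C_space_vecD[OF x]])
      also have "\<dots> \<le> 3 ^ l * (C_norm a b l (\<lambda>t. A t $ i $ j) * C_norm_vec a b l x)"
        by (intro mult_left_mono C_norm_component_le x C_norm_nonneg[OF A']) auto
      finally show "C_norm a b l (\<lambda>t. A t $ i $ j * x t $ j) \<le> \<dots>" .
    qed
    finally show "C_norm a b l (\<lambda>t. \<Sum>j\<in>UNIV. A t $ i $ j * x t $ j) \<le> \<dots>" .
  qed
  also have "\<dots> = 3 ^ l * (C_norm_mat a b l A * C_norm_vec a b l x)"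
    by (simp add: C_norm_mat_def sum_distrib_left sum_distrib_right)
  finally show "C_norm_vec a b l (\<lambda>t. A t *v x t) \<le> 3 ^ l * (C_norm_mat a b l A * C_norm_vec a b l x)" .
qed

lemma C_space_vec_ivl_deriv:
  assumes x: "x \<in> C_space_vec a b l" and "n + p \<le> l"
  shows "ivl_deriv a b p x \<in> C_space_vec a b n"
    and "C_norm_vec a b n (ivl_deriv a b p x) = (\<Sum>i\<in>UNIV. C_norm a b n (ivl_deriv a b p (\<lambda>t. x t $ i)))"
    and "C_norm_vec a b n (ivl_deriv a b p x) \<le> C_norm_vec a b l x"
proof -
  have eq: "ivl_deriv a b p x t $ i = ivl_deriv a b p (\<lambda>t. x t $ i) t" if "t \<in> {a..b}" for i t
    using ivl_deriv_component[OF x _ that] assms by auto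
  show "ivl_deriv a b p x \<in> C_space_vec a b n"
    unfolding C_space_vec_def
    using C_space_cong[OF eq C_space_ivl_deriv[OF C_space_vecD[OF x] assms(2)]] by auto
  show n: "C_norm_vec a b n (ivl_deriv a b p x) = (\<Sum>i\<in>UNIV. C_norm a b n (ivl_deriv a b p (\<lambda>t. x t $ i)))"
    unfolding C_norm_vec_def using C_norm_cong[OF eq] by simp
  show "C_norm_vec a b n (ivl_deriv a b p x) \<le> C_norm_vec a b l x"
    unfolding n unfolding C_norm_vec_def
    by (intro sum_mono C_norm_ivl_deriv_le C_space_vecD[OF x] assms(2))
qed

lemma C_norm_vec_Suc_le:
  assumes x: "x \<in> C_space_vec a b (Suc (p + n))"
  shows "C_norm_vec a b (Suc (p + n)) x \<le> C_norm_vec a b (p + n) x + C_norm_vec a b p (ivl_deriv a b (Suc n) x)"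
  using C_space_vec_ivl_deriv(2)[OF x, of p "Suc n"]
  by (simp add: C_norm_vec_def[of a b "_ + _"] C_norm_vec_def[of a b "Suc _"] sum.distrib[symmetric]
    sum_mono C_norm_Suc_le[OF C_space_vecD[OF x]] del: ivl_deriv.simps)

lemma C_space_vec_complete:
  fixes x :: "nat \<Rightarrow> real \<Rightarrow> complex^'m"
  assumes x: "\<And>k. x k \<in> C_space_vec a b l"
    and cauchy: "\<And>e. e > 0 \<Longrightarrow> \<exists>M. \<forall>m\<ge>M. \<forall>p\<ge>M. C_norm_vec a b l (\<lambda>t. x m t - x p t) < e"
  shows "\<exists>g\<in>C_space_vec a b l. (\<lambda>k. C_norm_vec a b l (\<lambda>t. x k t - g t)) \<longlonglongrightarrow> 0"
proof -
  have "\<exists>g\<in>C_space a b l. (\<lambda>k. C_norm a b l (\<lambda>t. x k t $ i - g t)) \<longlonglongrightarrow> 0" for i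
  proof (rule C_space_complete)
    fix e :: real assume "e > 0"
    then obtain M where M: "\<forall>m\<ge>M. \<forall>p\<ge>M. C_norm_vec a b l (\<lambda>t. x m t - x p t) < e"
      using cauchy by blast
    have "C_norm a b l (\<lambda>t. x m t $ i - x p t $ i) < e" if "m \<ge> M" "p \<ge> M" for m p
      using M that C_norm_component_le[OF C_space_vec_diff[OF x[of m] x[of p]], of i] by force
    then show "\<exists>M. \<forall>m\<ge>M. \<forall>p\<ge>M. C_norm a b l (\<lambda>t. x m t $ i - x p t $ i) < e" by blast
  qed (rule C_space_vecD[OF x])
  then have "\<forall>i. \<exists>g. g \<in> C_space a b l \<and> (\<lambda>k. C_norm a b l (\<lambda>t. x k t $ i - g t)) \<longlonglongrightarrow> 0"
    by blast
  from choice[OF this] obtain g where g: "\<And>i. g i \<in> C_space a b l"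
    "\<And>i. (\<lambda>k. C_norm a b l (\<lambda>t. x k t $ i - g i t)) \<longlonglongrightarrow> 0" by blast
  have "(\<lambda>k. \<Sum>i\<in>UNIV. C_norm a b l (\<lambda>t. x k t $ i - g i t)) \<longlonglongrightarrow> (\<Sum>i\<in>(UNIV :: 'm set). 0)"
    by (intro tendsto_sum g)
  then show ?thesis
    by (intro bexI[of _ "\<lambda>t. \<chi> i. g i t"]) (auto simp: C_norm_vec_def C_space_vec_def g)
qed


section \<open>Compactness\<close>

text \<open>One bounded derivative more gives the equicontinuity needed for Arzela--Ascoli.\<close>
lemma ivl_deriv_lipschitz:
  assumes "x \<in> C_space a b (Suc l)" "j \<le> l" "s \<in> {a..b}" "t \<in> {a..b}"
  shows "norm (ivl_deriv a b j x s - ivl_deriv a b j x t) \<le> C_norm a b (Suc l) x * norm (s - t)"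
proof (rule differentiable_bound[of "{a..b}"])
  fix u assume u: "u \<in> {a..b}"
  show "(ivl_deriv a b j x has_derivative (\<lambda>h. h *\<^sub>R ivl_deriv a b (Suc j) x u)) (at u within {a..b})"
    using C_space_has_derivative[OF assms(1) _ u, of j] assms(2)
    by (simp add: has_vector_derivative_def)
  show "onorm (\<lambda>h. h *\<^sub>R ivl_deriv a b (Suc j) x u) \<le> C_norm a b (Suc l) x"
    by (rule onorm_le)
      (use norm_ivl_deriv_le[OF assms(1) _ u, of "Suc j"] assms(2) in
        \<open>auto simp: mult.commute intro!: mult_left_mono simp del: ivl_deriv.simps\<close>)
qed (use assms in auto)

text \<open>The embedding of \<open>C\<^sup>l\<^sup>+\<^sup>1\<close> into \<open>C\<^sup>l\<close> is compact. The Cauchy property suffices: the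
  limit is taken later, in a stronger norm.\<close>
lemma bounded_imp_Cauchy_subsequence:
  fixes x :: "nat \<Rightarrow> real \<Rightarrow> complex^'m"
  assumes x: "\<And>k. x k \<in> C_space_vec a b (Suc l)"
    and bounded: "\<And>k. C_norm_vec a b (Suc l) (x k) \<le> M"
  shows "\<exists>s::nat \<Rightarrow> nat. strict_mono s \<and>
    (\<forall>e>0. \<exists>M. \<forall>m\<ge>M. \<forall>p\<ge>M. C_norm_vec a b l (\<lambda>t. x (s m) t - x (s p) t) < e)"
proof -
  define y where "y = (\<lambda>(i, j) k. ivl_deriv a b j (\<lambda>t. x k t $ i))"
  have xi: "(\<lambda>t. x k t $ i) \<in> C_space a b (Suc l)" for k i
    using C_space_vecD[OF x] .
  have xb: "C_norm a b (Suc l) (\<lambda>t. x k t $ i) \<le> M" for k i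
    using C_norm_component_le[OF x] bounded order_trans by blast
  have "\<exists>s. strict_mono s \<and> (\<forall>q\<in>UNIV \<times> {..l}. uniformly_Cauchy_on {a..b} (\<lambda>k. y q (s k)))"
  proof (rule finite_common_subsequence)
    fix q :: "'m \<times> nat" and s :: "nat \<Rightarrow> nat"
    assume "q \<in> UNIV \<times> {..l}"
    then obtain i j where q: "q = (i, j)" "j \<le> l" by auto
    have yb: "norm (y q k t) \<le> \<bar>M\<bar> + 1" if "t \<in> {a..b}" for k t
      using norm_ivl_deriv_le[OF xi _ that, of j k i] xb[of k i] q by (auto simp: y_def)
    have yl: "norm (y q k u - y q k t) \<le> (\<bar>M\<bar> + 1) * norm (u - t)"
      if "u \<in> {a..b}" "t \<in> {a..b}" for k u t
    proof -
      have "norm (y q k u - y q k t) \<le> C_norm a b (Suc l) (\<lambda>t. x k t $ i) * norm (u - t)"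
        using ivl_deriv_lipschitz[OF xi q(2) that] q by (simp add: y_def)
      also have "\<dots> \<le> (\<bar>M\<bar> + 1) * norm (u - t)"
        using xb[of k i] by (intro mult_right_mono) auto
      finally show ?thesis .
    qed
    obtain g r where gr: "strict_mono (r :: nat \<Rightarrow> nat)"
      "\<And>e. 0 < e \<Longrightarrow> \<exists>N. \<forall>n t. n \<ge> N \<and> t \<in> {a..b} \<longrightarrow> norm (y q (s (r n)) t - g t) < e"
    proof (rule Arzela_Ascoli[of "{a..b}" "\<lambda>k. y q (s k)" "\<bar>M\<bar> + 1"])
      fix t e :: real assume "t \<in> {a..b}" "0 < e"
      have "norm (y q (s k) t - y q (s k) u) < e"
        if "u \<in> {a..b}" "norm (t - u) < e / (\<bar>M\<bar> + 1)" for k u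
      proof -
        have "norm (y q (s k) t - y q (s k) u) \<le> (\<bar>M\<bar> + 1) * norm (t - u)"
          using yl \<open>t \<in> {a..b}\<close> that by blast
        also have "\<dots> < e" using that by (simp add: field_simps)
        finally show ?thesis .
      qed
      then show "\<exists>d>0. \<forall>k u. u \<in> {a..b} \<and> norm (t - u) < d \<longrightarrow> norm (y q (s k) t - y q (s k) u) < e"
        using \<open>0 < e\<close> by (intro exI[of _ "e / (\<bar>M\<bar> + 1)"]) auto
    qed (use yb in auto)
    have "uniform_limit {a..b} (\<lambda>k. y q (s (r k))) g sequentially"
      unfolding uniform_limit_sequentially_iff
    proof (intro allI impI)
      fix e :: real assume "e > 0"
      from gr(2)[OF this] obtain N where
        "\<forall>n t. n \<ge> N \<and> t \<in> {a..b} \<longrightarrow> norm (y q (s (r n)) t - g t) < e" ..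
      then show "\<exists>N. \<forall>n\<ge>N. \<forall>t\<in>{a..b}. dist (y q (s (r n)) t) (g t) < e"
        unfolding dist_norm by blast
    qed
    then have "uniformly_Cauchy_on {a..b} (\<lambda>k. y q ((s \<circ> r) k))"
      unfolding uniformly_convergent_eq_Cauchy[symmetric] uniformly_convergent_on_def by auto
    then show "\<exists>r. strict_mono r \<and> uniformly_Cauchy_on {a..b} (\<lambda>k. y q ((s \<circ> r) k))"
      using gr(1) by blast
  next
    fix q :: "'m \<times> nat" and s r :: "nat \<Rightarrow> nat"
    assume c: "uniformly_Cauchy_on {a..b} (\<lambda>k. y q (s k))" and r: "strict_mono r"
    show "uniformly_Cauchy_on {a..b} (\<lambda>k. y q ((s \<circ> r) k))"
      unfolding uniformly_Cauchy_on_def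
    proof (intro allI impI)
      fix e :: real assume "e > 0"
      then obtain N where "\<forall>t\<in>{a..b}. \<forall>m\<ge>N. \<forall>n\<ge>N. dist (y q (s m) t) (y q (s n) t) < e"
        using c unfolding uniformly_Cauchy_on_def by blast
      moreover have "n \<ge> N \<Longrightarrow> r n \<ge> N" for n
        using seq_suble[OF r, of n] by simp
      ultimately show "\<exists>N. \<forall>t\<in>{a..b}. \<forall>m\<ge>N. \<forall>n\<ge>N. dist (y q ((s \<circ> r) m) t) (y q ((s \<circ> r) n) t) < e"
        by (intro exI[of _ N]) auto
    qed
  qed auto
  then obtain s where s: "strict_mono s"
    "\<And>i j. j \<le> l \<Longrightarrow> uniformly_Cauchy_on {a..b} (\<lambda>k. y (i, j) (s k))" by auto
  have "\<exists>N. \<forall>m\<ge>N. \<forall>p\<ge>N. C_norm_vec a b l (\<lambda>t. x (s m) t - x (s p) t) < e" if "e > 0" for e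
  proof -
    define d where "d = e / (2 * (real CARD('m) * real (Suc l)))"
    have pos: "real CARD('m) * real (Suc l) > 0" by simp
    have "d > 0" using \<open>e > 0\<close> pos unfolding d_def by (intro divide_pos_pos mult_pos_pos) auto
    have "\<exists>N. \<forall>t\<in>{a..b}. \<forall>m\<ge>N. \<forall>n\<ge>N. dist (y q (s m) t) (y q (s n) t) < d"
      if "q \<in> UNIV \<times> {..l}" for q
      using s(2) that \<open>d > 0\<close> unfolding uniformly_Cauchy_on_def by auto
    then obtain N where N: "\<And>q t m n. q \<in> UNIV \<times> {..l} \<Longrightarrow> t \<in> {a..b} \<Longrightarrow> m \<ge> N q \<Longrightarrow> n \<ge> N q \<Longrightarrow>
      dist (y q (s m) t) (y q (s n) t) < d" by metis
    define N0 where "N0 = Max (N ` (UNIV \<times> {..l}))"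
    have N0: "N q \<le> N0" if "q \<in> UNIV \<times> {..l}" for q
      unfolding N0_def by (rule Max_ge) (use that in auto)
    have "C_norm_vec a b l (\<lambda>t. x (s m) t - x (s p) t) < e" if "m \<ge> N0" "p \<ge> N0" for m p
    proof -
      have "C_norm_vec a b l (\<lambda>t. x (s m) t - x (s p) t) \<le> (\<Sum>i\<in>(UNIV :: 'm set). real (Suc l) * d)"
        unfolding C_norm_vec_def
      proof (intro sum_mono C_norm_le)
        fix i :: 'm and j t assume j: "j \<le> l" and t: "t \<in> {a..b}"
        have "dist (y (i, j) (s m) t) (y (i, j) (s p) t) < d"
          using N[of "(i, j)"] N0[of "(i, j)"] j t that by auto
        moreover have "ivl_deriv a b j (\<lambda>t. (x (s m) t - x (s p) t) $ i) t = y (i, j) (s m) t - y (i, j) (s p) t"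
          using ivl_deriv_diff[OF xi xi, of j t] j t by (simp add: y_def)
        ultimately show "norm (ivl_deriv a b j (\<lambda>t. (x (s m) t - x (s p) t) $ i) t) \<le> d"
          by (simp add: dist_norm)
      qed
      also have "\<dots> = e / 2" using pos by (simp add: d_def)
      also have "\<dots> < e" using \<open>e > 0\<close> by simp
      finally show ?thesis .
    qed
    then show ?thesis by blast
  qed
  then show ?thesis using s(1) by blast
qed


section \<open>The differential operator\<close>
lemma ivl_deriv_vec_diff:
  fixes x y :: "real \<Rightarrow> complex^'m"
  assumes x: "x \<in> C_space_vec a b l" and y: "y \<in> C_space_vec a b l" and k: "k \<le> l" and t: "t \<in> {a..b}"
  shows "ivl_deriv a b k (\<lambda>t. x t - y t) t = ivl_deriv a b k x t - ivl_deriv a b k y t"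
proof (rule vec_eq_iff[THEN iffD2], rule allI)
  fix i
  show "ivl_deriv a b k (\<lambda>t. x t - y t) t $ i = (ivl_deriv a b k x t - ivl_deriv a b k y t) $ i"
    using ivl_deriv_diff[OF C_space_vecD[OF x, of i] C_space_vecD[OF y, of i] k t]
    by (simp add: ivl_deriv_component[OF _ k t] C_space_vec_diff[OF x y] x y)
qed

lemma ivl_deriv_vec_scale:
  fixes x :: "real \<Rightarrow> complex^'m"
  assumes x: "x \<in> C_space_vec a b l" and k: "k \<le> l" and t: "t \<in> {a..b}"
  shows "ivl_deriv a b k (\<lambda>t. c *s x t) t = c *s ivl_deriv a b k x t"
proof (rule vec_eq_iff[THEN iffD2], rule allI)
  fix i
  show "ivl_deriv a b k (\<lambda>t. c *s x t) t $ i = (c *s ivl_deriv a b k x t) $ i"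
    using ivl_deriv_scale[OF C_space_vecD[OF x, of i] k t]
    by (simp add: ivl_deriv_component[OF _ k t] C_space_vec_scale[OF x] x)
qed

lemma C_space_mat_diff:
  "A \<in> C_space_mat a b l \<Longrightarrow> A' \<in> C_space_mat a b l \<Longrightarrow> (\<lambda>t. A t - A' t) \<in> C_space_mat a b l"
  by (simp add: C_space_mat_def C_space_diff)

lemma C_norm_mat_nonneg: "A \<in> C_space_mat a b l \<Longrightarrow> 0 \<le> C_norm_mat a b l A"
  unfolding C_norm_mat_def by (intro sum_nonneg C_norm_nonneg) (simp add: C_space_mat_def)

lemma diff_op_eq: "diff_op a b r K z = (\<lambda>t. ivl_deriv a b r z t + lower_part a b r K z t)"
  by (simp add: diff_op_def lower_part_def)

lemma coeff_norm_nonneg: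
  "K \<in> coeff_space a b n r \<Longrightarrow> 0 \<le> coeff_norm a b n r K"
  unfolding coeff_norm_def coeff_space_def by (intro sum_nonneg C_norm_mat_nonneg) blast

text \<open>The regularity \<open>n + r - 1\<close> enters because the lower-order part takes at most \<open>r - 1\<close> derivatives;
  one derivative less than in the leading term is what makes it a compact perturbation.\<close>

lemma
  fixes z :: "real \<Rightarrow> complex^'m"
  assumes K: "K \<in> coeff_space a b n r"
    and z: "z \<in> C_space_vec a b (n + r - 1)"
  shows lower_part_space: "lower_part a b r K z \<in> C_space_vec a b n"
    and lower_part_bound:
      "C_norm_vec a b n (lower_part a b r K z) \<le> 3 ^ n * coeff_norm a b n r K * C_norm_vec a b (n + r - 1) z"
proof -
  have Kj: "K (r - j) \<in> C_space_mat a b n" if "j \<in> {1..r}" for j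
    using K that by (simp add: coeff_space_def)
  have d: "ivl_deriv a b (r - j) z \<in> C_space_vec a b n"
    "C_norm_vec a b n (ivl_deriv a b (r - j) z) \<le> C_norm_vec a b (n + r - 1) z" if "j \<in> {1..r}" for j
    using C_space_vec_ivl_deriv[OF z, of n "r - j"] that by auto
  show "lower_part a b r K z \<in> C_space_vec a b n"
    unfolding lower_part_def
    by (intro C_space_vec_sum C_space_mat_vec_mult Kj d)
  have "C_norm_vec a b n (lower_part a b r K z)
      \<le> (\<Sum>j=1..r. C_norm_vec a b n (\<lambda>t. K (r - j) t *v ivl_deriv a b (r - j) z t))"
    unfolding lower_part_def
    by (intro C_norm_vec_sum C_space_mat_vec_mult Kj d)
  also have "\<dots> \<le> (\<Sum>j=1..r. 3 ^ n * (C_norm_mat a b n (K (r - j)) * C_norm_vec a b (n + r - 1) z))"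
  proof (rule sum_mono)
    fix j assume j: "j \<in> {1..r}"
    have "C_norm_vec a b n (\<lambda>t. K (r - j) t *v ivl_deriv a b (r - j) z t)
      \<le> 3 ^ n * (C_norm_mat a b n (K (r - j)) * C_norm_vec a b n (ivl_deriv a b (r - j) z))"
      by (rule C_norm_mat_vec_mult[OF Kj[OF j] d(1)[OF j]])
    also have "\<dots> \<le> 3 ^ n * (C_norm_mat a b n (K (r - j)) * C_norm_vec a b (n + r - 1) z)"
      by (intro mult_left_mono d j C_norm_mat_nonneg Kj) auto
    finally show "C_norm_vec a b n (\<lambda>t. K (r - j) t *v ivl_deriv a b (r - j) z t) \<le> \<dots>" .
  qed
  also have "\<dots> = 3 ^ n * coeff_norm a b n r K * C_norm_vec a b (n + r - 1) z"
    by (simp add: coeff_norm_def sum_distrib_left sum_distrib_right mult.assoc)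
  finally show "C_norm_vec a b n (lower_part a b r K z) \<le> 3 ^ n * coeff_norm a b n r K * C_norm_vec a b (n + r - 1) z" .
qed

lemma C_space_vec_mono: "x \<in> C_space_vec a b l \<Longrightarrow> k \<le> l \<Longrightarrow> x \<in> C_space_vec a b k"
  by (auto simp: C_space_vec_def intro: C_space_mono)

lemma C_norm_vec_mono: "x \<in> C_space_vec a b l \<Longrightarrow> k \<le> l \<Longrightarrow> C_norm_vec a b k x \<le> C_norm_vec a b l x"
  using C_space_vec_ivl_deriv(3)[of x l k 0] by simp

text \<open>Since \<open>diff_op a b r K z\<close> is \<open>ivl_deriv a b r z\<close> plus a part that involves only derivatives of \<open>z\<close> of
  order less than \<open>r\<close>, the norm of either one is controlled by that of the other up to the weaker norm of order
  \<open>n + r - 1\<close>. The a priori estimate turns convergence in that weaker norm into convergence in full.\<close>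
lemma
  fixes z :: "real \<Rightarrow> complex^'m"
  assumes r: "r \<ge> 1"
    and K: "K \<in> coeff_space a b n r"
    and z: "z \<in> C_space_vec a b (n + r)"
  shows diff_op_space: "diff_op a b r K z \<in> C_space_vec a b n"
    and diff_op_bound:
      "C_norm_vec a b n (diff_op a b r K z) \<le> (1 + 3 ^ n * coeff_norm a b n r K) * C_norm_vec a b (n + r) z"
    and diff_op_a_priori:
      "C_norm_vec a b (n + r) z \<le> C_norm_vec a b n (diff_op a b r K z)
         + (1 + 3 ^ n * coeff_norm a b n r K) * C_norm_vec a b (n + r - 1) z"
proof -
  have z': "z \<in> C_space_vec a b (n + r - 1)"
    using C_space_vec_mono[OF z, of "n + r - 1"] by simp
  note lp = lower_part_space[OF K z'] lower_part_bound[OF K z']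
  note dr = C_space_vec_ivl_deriv[OF z order_refl]
  show sp: "diff_op a b r K z \<in> C_space_vec a b n"
    unfolding diff_op_eq by (intro C_space_vec_add lp dr)
  have "C_norm_vec a b n (diff_op a b r K z)
      \<le> C_norm_vec a b n (ivl_deriv a b r z) + C_norm_vec a b n (lower_part a b r K z)"
    unfolding diff_op_eq by (intro C_norm_vec_triangle lp dr)
  also have "\<dots> \<le> C_norm_vec a b (n + r) z + 3 ^ n * coeff_norm a b n r K * C_norm_vec a b (n + r) z"
  proof (intro add_mono dr)
    have "3 ^ n * coeff_norm a b n r K * C_norm_vec a b (n + r - 1) z
      \<le> 3 ^ n * coeff_norm a b n r K * C_norm_vec a b (n + r) z"
      using coeff_norm_nonneg[OF K] C_norm_vec_mono[OF z, of "n + r - 1"]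
      by (intro mult_left_mono) auto
    then show "C_norm_vec a b n (lower_part a b r K z) \<le> \<dots>" using lp(2) by linarith
  qed
  finally show "C_norm_vec a b n (diff_op a b r K z)
      \<le> (1 + 3 ^ n * coeff_norm a b n r K) * C_norm_vec a b (n + r) z"
    by (simp add: algebra_simps)
  obtain p where p: "r = Suc p" using r by (cases r) auto
  have "C_norm_vec a b (n + r) z \<le> C_norm_vec a b (n + r - 1) z + C_norm_vec a b n (ivl_deriv a b r z)"
    using C_norm_vec_Suc_le[of z n p] z unfolding p by (simp del: ivl_deriv.simps)
  also have "ivl_deriv a b r z = (\<lambda>t. diff_op a b r K z t - lower_part a b r K z t)"
    by (simp add: diff_op_eq)
  also have "C_norm_vec a b n (\<lambda>t. diff_op a b r K z t - lower_part a b r K z t)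
      \<le> C_norm_vec a b n (diff_op a b r K z) + C_norm_vec a b n (lower_part a b r K z)"
    by (rule C_norm_vec_triangle_diff[OF sp lp(1)])
  finally show "C_norm_vec a b (n + r) z \<le> C_norm_vec a b n (diff_op a b r K z)
         + (1 + 3 ^ n * coeff_norm a b n r K) * C_norm_vec a b (n + r - 1) z"
    using lp(2) by (simp add: algebra_simps)
qed

text \<open>The leading terms cancel, so the difference is the lower-order part with the differences of the
  coefficients, which is small in operator norm when these are small in \<open>C\<^sup>n\<close>.\<close>
lemma diff_op_coeff_bound:
  fixes z :: "real \<Rightarrow> complex^'m"
  assumes K: "K \<in> coeff_space a b n r"
    and K': "K' \<in> coeff_space a b n r"
    and z: "z \<in> C_space_vec a b (n + r)"
  shows "C_norm_vec a b n (\<lambda>t. diff_op a b r K z t - diff_op a b r K' z t)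
    \<le> 3 ^ n * coeff_norm a b n r (\<lambda>j t. K j t - K' j t) * C_norm_vec a b (n + r) z"
proof -
  have "(\<lambda>t. diff_op a b r K z t - diff_op a b r K' z t) = lower_part a b r (\<lambda>j t. K j t - K' j t) z"
    by (simp add: diff_op_def lower_part_def sum_subtractf matrix_vector_mult_diff_rdistrib)
  moreover have z': "z \<in> C_space_vec a b (n + r - 1)"
    using C_space_vec_mono[OF z, of "n + r - 1"] by simp
  moreover have KK: "(\<lambda>j t. K j t - K' j t) \<in> coeff_space a b n r"
    using K K' by (simp add: coeff_space_def C_space_mat_diff)
  ultimately have "C_norm_vec a b n (\<lambda>t. diff_op a b r K z t - diff_op a b r K' z t)
    \<le> 3 ^ n * coeff_norm a b n r (\<lambda>j t. K j t - K' j t) * C_norm_vec a b (n + r - 1) z"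
    using lower_part_bound[OF KK z'] by simp
  also have "\<dots> \<le> 3 ^ n * coeff_norm a b n r (\<lambda>j t. K j t - K' j t) * C_norm_vec a b (n + r) z"
    using coeff_norm_nonneg[OF KK] C_norm_vec_mono[OF z, of "n + r - 1"]
    by (intro mult_left_mono) auto
  finally show ?thesis .
qed

lemma diff_op_diff:
  fixes z w :: "real \<Rightarrow> complex^'m"
  assumes z: "z \<in> C_space_vec a b (n + r)" and w: "w \<in> C_space_vec a b (n + r)" and t: "t \<in> {a..b}"
  shows "diff_op a b r K (\<lambda>t. z t - w t) t = diff_op a b r K z t - diff_op a b r K w t"
proof -
  have "ivl_deriv a b k (\<lambda>t. z t - w t) t = ivl_deriv a b k z t - ivl_deriv a b k w t" if "k \<le> r" for k
    by (rule ivl_deriv_vec_diff[OF z w _ t]) (use that in simp)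
  then show ?thesis
    by (simp add: diff_op_def matrix_vector_mult_diff_distrib sum_subtractf)
qed

lemma diff_op_scale:
  fixes z :: "real \<Rightarrow> complex^'m"
  assumes z: "z \<in> C_space_vec a b (n + r)" and t: "t \<in> {a..b}"
  shows "diff_op a b r K (\<lambda>t. c *s z t) t = c *s diff_op a b r K z t"
proof -
  have "ivl_deriv a b k (\<lambda>t. c *s z t) t = c *s ivl_deriv a b k z t" if "k \<le> r" for k
    by (rule ivl_deriv_vec_scale[OF z _ t]) (use that in simp)
  then show ?thesis
    by (simp add: diff_op_def vector_scalar_commute vector_add_ldistrib vec.scale_sum_right)
qed

section \<open>Uniform boundedness of the boundary operators\<close>
lemma continuous_linear_op_scale:
  "continuous_linear_op a b l T \<Longrightarrow> x \<in> C_space_vec a b l \<Longrightarrow> T (\<lambda>t. c *s x t) = c *s T x"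
  by (simp add: continuous_linear_op_def)

lemma continuous_linear_op_add:
  "continuous_linear_op a b l T \<Longrightarrow> x \<in> C_space_vec a b l \<Longrightarrow> y \<in> C_space_vec a b l \<Longrightarrow>
    T (\<lambda>t. x t + y t) = T x + T y"
  by (simp add: continuous_linear_op_def)

lemma continuous_linear_op_diff:
  assumes T: "continuous_linear_op a b l T" and x: "x \<in> C_space_vec a b l" and y: "y \<in> C_space_vec a b l"
  shows "T (\<lambda>t. x t - y t) = T x - T y"
proof -
  have "(\<lambda>t. x t - y t) = (\<lambda>t. x t + (-1) *s y t)" by (simp add: vec_eq_iff fun_eq_iff)
  then show ?thesis
    using continuous_linear_op_add[OF T x C_space_vec_scale[OF y, of "-1"]]
      continuous_linear_op_scale[OF T y, of "-1"] by (simp add: vec_eq_iff)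
qed

lemma C_norm_vec_triangle_via:
  assumes "x \<in> C_space_vec a b l" "y \<in> C_space_vec a b l" "w \<in> C_space_vec a b l"
  shows "C_norm_vec a b l (\<lambda>t. x t - y t)
    \<le> C_norm_vec a b l (\<lambda>t. x t - w t) + C_norm_vec a b l (\<lambda>t. w t - y t)"
  using C_norm_vec_triangle[OF C_space_vec_diff[OF assms(1,3)] C_space_vec_diff[OF assms(3,2)]]
  by simp

text \<open>A Baire-type argument with nested balls. If no uniform bound holds, every ball contains a smaller
  ball on which some \<open>B \<epsilon>\<close> with \<open>\<epsilon> < 1 / m\<close> exceeds \<open>m\<close> throughout: one of \<open>x + z'\<close>, \<open>x - z'\<close> does so when
  \<open>B \<epsilon> z'\<close> is large, and continuity gives a neighbourhood. At the common point of the balls the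
  family is unbounded as \<open>\<epsilon>\<close> tends to 0.\<close>
lemma uniform_boundedness:
  fixes B :: "real \<Rightarrow> (real \<Rightarrow> complex^'m) \<Rightarrow> complex^'k"
  assumes e0: "\<epsilon>0 > 0"
    and B: "\<And>\<epsilon>. \<epsilon> \<in> {0<..<\<epsilon>0} \<Longrightarrow> continuous_linear_op a b l (B \<epsilon>)"
    and bounded: "\<And>z. z \<in> C_space_vec a b l \<Longrightarrow> \<exists>M. \<forall>\<^sub>F \<epsilon> in at_right 0. sum_norm (B \<epsilon> z) \<le> M"
  shows "\<exists>\<delta> \<beta>. 0 < \<delta> \<and> \<delta> \<le> \<epsilon>0 \<and> 0 < \<beta> \<and>
    (\<forall>\<epsilon>\<in>{0<..<\<delta>}. \<forall>z\<in>C_space_vec a b l. sum_norm (B \<epsilon> z) \<le> \<beta> * C_norm_vec a b l z)"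
proof (rule ccontr)
  let ?X = "C_space_vec a b l :: (real \<Rightarrow> complex^'m) set" and ?N = "C_norm_vec a b l :: (real \<Rightarrow> complex^'m) \<Rightarrow> real"
  assume contr: "\<not> ?thesis"
  have unbounded: "\<exists>\<epsilon>\<in>{0<..<\<delta>}. \<exists>z\<in>?X. sum_norm (B \<epsilon> z) > \<beta> * ?N z"
    if "0 < \<delta>" "\<delta> \<le> \<epsilon>0" "0 < \<beta>" for \<delta> \<beta>
    using contr that by (meson not_le)
  have step: "\<exists>y \<rho>' \<epsilon>. y \<in> ?X \<and> 0 < \<rho>' \<and> ?N (\<lambda>t. y t - x t) + \<rho>' \<le> \<rho> \<and> \<rho>' \<le> \<rho> / 2 \<and>
      0 < \<epsilon> \<and> \<epsilon> < 1 / m \<and> (\<forall>y'\<in>?X. ?N (\<lambda>t. y' t - y t) \<le> \<rho>' \<longrightarrow> m < sum_norm (B \<epsilon> y'))"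
    if x: "x \<in> ?X" and \<rho>: "0 < \<rho>" and m: "0 < m" for x \<rho> m
  proof -
    have "0 < min \<epsilon>0 (1 / m)" "0 < 2 * m / \<rho>" using e0 \<rho> m by auto
    from unbounded[OF this(1) _ this(2)] obtain \<epsilon> z where
      eps: "0 < \<epsilon>" "\<epsilon> < \<epsilon>0" "\<epsilon> < 1 / m" and z: "z \<in> ?X" and
      big: "sum_norm (B \<epsilon> z) > 2 * m / \<rho> * ?N z" by auto
    have T: "continuous_linear_op a b l (B \<epsilon>)" using B eps by auto
    define u where "u = sum_norm (B \<epsilon> z)"
    have u: "u > 0"
    proof -
      have "0 \<le> 2 * m / \<rho> * ?N z" using C_norm_vec_nonneg[OF z] \<rho> m by auto
      then show ?thesis using big unfolding u_def by linarith
    qed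
    \<comment> \<open>Scaling \<open>z\<close> to the value \<open>2 * m\<close> under \<open>B \<epsilon>\<close>, rather than to a prescribed norm, also covers
      the case of a vanishing norm of \<open>z\<close>.\<close>
    define z' where "z' = (\<lambda>t. complex_of_real (2 * m / u) *s z t)"
    have z': "z' \<in> ?X" unfolding z'_def by (rule C_space_vec_scale[OF z])
    have Bz': "sum_norm (B \<epsilon> z') = 2 * m"
      unfolding z'_def continuous_linear_op_scale[OF T z] sum_norm_scale u_def[symmetric]
      using u m by (simp add: norm_divide norm_mult)
    have "?N z' = 2 * m / u * ?N z"
      unfolding z'_def C_norm_vec_scale[OF z] using u m by (simp add: norm_divide norm_mult)
    also have "\<dots> < \<rho>" using big u \<rho> m unfolding u_def[symmetric] by (simp add: field_simps)
    finally have Nz': "?N z' < \<rho>" .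
    have sum2: "2 * sum_norm (B \<epsilon> z') \<le> sum_norm (B \<epsilon> (\<lambda>t. x t + z' t)) + sum_norm (B \<epsilon> (\<lambda>t. x t - z' t))"
    proof -
      have "B \<epsilon> (\<lambda>t. x t + z' t) - B \<epsilon> (\<lambda>t. x t - z' t) = 2 *s B \<epsilon> z'"
        unfolding continuous_linear_op_add[OF T x z'] continuous_linear_op_diff[OF T x z']
        by (simp add: vec_eq_iff)
      then show ?thesis
        using sum_norm_triangle_diff[of "B \<epsilon> (\<lambda>t. x t + z' t)" "B \<epsilon> (\<lambda>t. x t - z' t)"]
          sum_norm_scale[of 2 "B \<epsilon> z'"] by simp
    qed
    have "\<exists>y\<in>?X. ?N (\<lambda>t. y t - x t) < \<rho> \<and> m < sum_norm (B \<epsilon> y)"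
    proof (cases "m < sum_norm (B \<epsilon> (\<lambda>t. x t + z' t))")
      case True
      then show ?thesis
        using Nz' C_space_vec_add[OF x z'] by (intro bexI[of _ "\<lambda>t. x t + z' t"]) auto
    next
      case False
      then have "m < sum_norm (B \<epsilon> (\<lambda>t. x t - z' t))" using sum2 Bz' m by linarith
      moreover have "?N (\<lambda>t. (x t - z' t) - x t) < \<rho>"
        using C_norm_vec_minus_commute[OF C_space_vec_diff[OF x z'] x] Nz' by simp
      ultimately show ?thesis
        using C_space_vec_diff[OF x z'] by (intro bexI[of _ "\<lambda>t. x t - z' t"]) auto
    qed
    then obtain y where y: "y \<in> ?X" "?N (\<lambda>t. y t - x t) < \<rho>" "m < sum_norm (B \<epsilon> y)" by blast
    then obtain d where d: "d > 0"
      "\<And>y'. y' \<in> ?X \<Longrightarrow> ?N (\<lambda>t. y' t - y t) < d \<Longrightarrow> sum_norm (B \<epsilon> y' - B \<epsilon> y) < sum_norm (B \<epsilon> y) - m"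
      using T unfolding continuous_linear_op_def by (metis diff_gt_0_iff_gt)
    define \<rho>' where "\<rho>' = min (d / 2) (min (\<rho> / 2) (\<rho> - ?N (\<lambda>t. y t - x t)))"
    have \<rho>': "0 < \<rho>'" "\<rho>' < d" "\<rho>' \<le> \<rho> / 2" "?N (\<lambda>t. y t - x t) + \<rho>' \<le> \<rho>"
      using d(1) y(2) \<rho> unfolding \<rho>'_def by linarith+
    have "m < sum_norm (B \<epsilon> y')" if "y' \<in> ?X" "?N (\<lambda>t. y' t - y t) \<le> \<rho>'" for y'
    proof -
      have "sum_norm (B \<epsilon> y' - B \<epsilon> y) < sum_norm (B \<epsilon> y) - m"
        using that \<rho>'(2) by (intro d(2)) auto
      moreover have "sum_norm (B \<epsilon> y) \<le> sum_norm (B \<epsilon> y') + sum_norm (B \<epsilon> y' - B \<epsilon> y)"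
        using sum_norm_triangle_diff[of "B \<epsilon> y'" "B \<epsilon> y' - B \<epsilon> y"] by simp
      ultimately show ?thesis by linarith
    qed
    then show ?thesis
      using y(1) eps \<rho>' by (intro exI[of _ y] exI[of _ \<rho>'] exI[of _ \<epsilon>]) auto
  qed
  \<comment> \<open>State of the construction: centre and radius of the current ball.\<close>
  define P where "P = (\<lambda>(n::nat) (x, \<rho>). x \<in> ?X \<and> (0::real) < \<rho>)"
  define Q where "Q = (\<lambda>n (x, \<rho>) (y, \<rho>'). ?N (\<lambda>t. y t - x t) + \<rho>' \<le> \<rho> \<and> \<rho>' \<le> \<rho> / 2 \<and>
      (\<exists>\<epsilon>. 0 < \<epsilon> \<and> \<epsilon> < 1 / real (Suc n) \<and>
        (\<forall>y'\<in>?X. ?N (\<lambda>t. y' t - y t) \<le> \<rho>' \<longrightarrow> real (Suc n) < sum_norm (B \<epsilon> y'))))"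
  have "\<exists>f. \<forall>n. P n (f n) \<and> Q n (f n) (f (Suc n))"
  proof (rule dependent_nat_choice)
    have "(\<lambda>t. 0) \<in> ?X" by (simp add: C_space_vec_def C_space_zero)
    then show "\<exists>q. P 0 q" by (intro exI[of _ "(\<lambda>t. 0, 1)"]) (simp add: P_def)
  next
    fix q n assume "P n q"
    then obtain x \<rho> where q: "q = (x, \<rho>)" "x \<in> ?X" "0 < \<rho>" by (auto simp: P_def)
    obtain y \<rho>' \<epsilon> where "y \<in> ?X \<and> 0 < \<rho>' \<and> ?N (\<lambda>t. y t - x t) + \<rho>' \<le> \<rho> \<and> \<rho>' \<le> \<rho> / 2 \<and>
      0 < \<epsilon> \<and> \<epsilon> < 1 / real (Suc n) \<and>
      (\<forall>y'\<in>?X. ?N (\<lambda>t. y' t - y t) \<le> \<rho>' \<longrightarrow> real (Suc n) < sum_norm (B \<epsilon> y'))"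
      using step[OF q(2,3), of "real (Suc n)"] by auto
    then show "\<exists>q'. P (Suc n) q' \<and> Q n q q'"
      unfolding P_def Q_def q by (intro exI[of _ "(y, \<rho>')"]) auto
  qed
  then obtain f where f: "\<And>n. P n (f n)" "\<And>n. Q n (f n) (f (Suc n))" by blast
  define x where "x n = fst (f n)" for n
  define \<rho> where "\<rho> n = snd (f n)" for n
  have x: "x n \<in> ?X" and \<rho>: "0 < \<rho> n" for n
    using f(1)[of n] by (auto simp: P_def x_def \<rho>_def split: prod.splits)
  have nest: "?N (\<lambda>t. x (Suc n) t - x n t) + \<rho> (Suc n) \<le> \<rho> n" and half: "\<rho> (Suc n) \<le> \<rho> n / 2"
    and large: "\<exists>\<epsilon>. 0 < \<epsilon> \<and> \<epsilon> < 1 / real (Suc n) \<and>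
        (\<forall>y'\<in>?X. ?N (\<lambda>t. y' t - x (Suc n) t) \<le> \<rho> (Suc n) \<longrightarrow> real (Suc n) < sum_norm (B \<epsilon> y'))" for n
    using f(2)[of n] by (auto simp: Q_def x_def \<rho>_def split: prod.splits)
  have in_ball: "?N (\<lambda>t. x (n + k) t - x n t) + \<rho> (n + k) \<le> \<rho> n" for n k
  proof (induction k)
    case 0
    then show ?case by (simp add: C_norm_vec_zero)
  next
    case (Suc k)
    then show ?case
      using nest[of "n + k"] C_norm_vec_triangle_via[OF x[of "Suc (n + k)"] x[of n] x[of "n + k"]] by simp
  qed
  have small: "\<rho> n \<le> \<rho> 0 / 2 ^ n" for n
  proof (induction n)
    case (Suc n)
    have "\<rho> (Suc n) \<le> \<rho> n / 2" by (rule half)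
    also have "\<dots> \<le> \<rho> 0 / 2 ^ n / 2" by (rule divide_right_mono[OF Suc]) simp
    finally show ?case by (simp add: mult.commute)
  qed simp
  have \<rho>_lim: "\<rho> \<longlonglongrightarrow> 0"
  proof (rule tendsto_sandwich[OF _ _ tendsto_const])
    have "(\<lambda>n. \<rho> 0 * (1 / 2) ^ n) \<longlonglongrightarrow> \<rho> 0 * 0" by (intro tendsto_intros LIMSEQ_power_zero) simp
    then show "(\<lambda>n. \<rho> 0 / 2 ^ n) \<longlonglongrightarrow> 0" by (simp add: power_divide)
    show "\<forall>\<^sub>F n in sequentially. 0 \<le> \<rho> n" using \<rho> by (simp add: less_imp_le)
    show "\<forall>\<^sub>F n in sequentially. \<rho> n \<le> \<rho> 0 / 2 ^ n" using small by simp
  qed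
  have close: "?N (\<lambda>t. x p t - x n t) \<le> \<rho> n" if "n \<le> p" for n p
    using in_ball[of n "p - n"] \<rho>[of p] that by simp
  have "\<exists>M. \<forall>m\<ge>M. \<forall>p\<ge>M. ?N (\<lambda>t. x m t - x p t) < e" if "e > 0" for e
  proof -
    have "\<forall>\<^sub>F n in sequentially. \<rho> n < e / 2"
      using order_tendstoD(2)[OF \<rho>_lim, of "e / 2"] \<open>e > 0\<close> by simp
    then obtain M where M: "\<rho> M < e / 2" unfolding eventually_sequentially by blast
    have "?N (\<lambda>t. x m t - x p t) < e" if "m \<ge> M" "p \<ge> M" for m p
      using C_norm_vec_triangle_via[OF x[of m] x[of p] x[of M]] close[OF that(1)] close[OF that(2)]
        C_norm_vec_minus_commute[OF x[of p] x[of M]] M by simp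
    then show ?thesis by blast
  qed
  from C_space_vec_complete[OF x this] obtain g where g: "g \<in> ?X"
    "(\<lambda>k. ?N (\<lambda>t. x k t - g t)) \<longlonglongrightarrow> 0" by blast
  have gball: "?N (\<lambda>t. g t - x n t) \<le> \<rho> n" for n
  proof -
    have "(\<lambda>p. ?N (\<lambda>t. x p t - g t) + \<rho> n) \<longlonglongrightarrow> 0 + \<rho> n" by (intro tendsto_intros g)
    moreover have "\<forall>\<^sub>F p in sequentially. ?N (\<lambda>t. g t - x n t) \<le> ?N (\<lambda>t. x p t - g t) + \<rho> n"
      using eventually_ge_at_top[of n]
    proof (rule eventually_mono)
      fix p assume "n \<le> p"
      then show "?N (\<lambda>t. g t - x n t) \<le> ?N (\<lambda>t. x p t - g t) + \<rho> n"
        using C_norm_vec_triangle_via[OF g(1) x[of n] x[of p]] close[of n p]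
          C_norm_vec_minus_commute[OF g(1) x[of p]] by simp
    qed
    ultimately show ?thesis using tendsto_lowerbound by fastforce
  qed
  obtain M where "\<forall>\<^sub>F \<epsilon> in at_right 0. sum_norm (B \<epsilon> g) \<le> M" using bounded[OF g(1)] by blast
  then obtain \<delta> where \<delta>: "\<delta> > 0" "\<And>\<epsilon>. 0 < \<epsilon> \<Longrightarrow> \<epsilon> < \<delta> \<Longrightarrow> sum_norm (B \<epsilon> g) \<le> M"
    unfolding eventually_at_right_field by auto
  obtain n :: nat where n: "max M (1 / \<delta>) < real n" using reals_Archimedean2 by blast
  obtain \<epsilon> where eps: "0 < \<epsilon>" "\<epsilon> < 1 / real (Suc n)" "real (Suc n) < sum_norm (B \<epsilon> g)"
    using large[of n] gball[of "Suc n"] g(1) by blast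
  have "1 / real (Suc n) < \<delta>" using n \<delta>(1) by (simp add: field_simps) 
  then show False using \<delta>(2)[of \<epsilon>] eps n by simp
qed

section \<open>Uniform injectivity\<close>

text \<open>The bounding constant \<open>\<beta>\<close> is what carries \<open>B (\<eta> k) (v k)\<close> to \<open>B 0 g\<close> when \<open>\<eta> k\<close> and \<open>v k\<close> vary
  together, as the operators converge only pointwise.\<close>
lemma uniform_inverse_bound:
  fixes K :: "real \<Rightarrow> nat \<Rightarrow> real \<Rightarrow> complex^'m^'m"
    and B :: "real \<Rightarrow> (real \<Rightarrow> complex^'m) \<Rightarrow> complex^'k"
  assumes r: "r \<ge> 1" and e0: "\<epsilon>0 > 0"
    and K: "\<And>\<epsilon>. \<epsilon> \<in> {0..<\<epsilon>0} \<Longrightarrow> K \<epsilon> \<in> coeff_space a b n r"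
    and B: "\<And>\<epsilon>. \<epsilon> \<in> {0..<\<epsilon>0} \<Longrightarrow> continuous_linear_op a b (n + r) (B \<epsilon>)"
    and inj: "\<And>z. bvp_solution a b n r (K 0) (B 0) (\<lambda>t. 0) 0 z \<Longrightarrow> (\<forall>t\<in>{a..b}. z t = 0)"
    and K_lim: "((\<lambda>\<epsilon>. coeff_norm a b n r (\<lambda>j t. K \<epsilon> j t - K 0 j t)) \<longlongrightarrow> 0) (at_right 0)"
    and B_lim: "\<And>z. z \<in> C_space_vec a b (n + r) \<Longrightarrow> ((\<lambda>\<epsilon>. B \<epsilon> z) \<longlongrightarrow> B 0 z) (at_right 0)"
    and \<delta>: "0 < \<delta>" "\<delta> \<le> \<epsilon>0"
    and \<beta>: "\<And>\<epsilon> z. \<epsilon> \<in> {0<..<\<delta>} \<Longrightarrow> z \<in> C_space_vec a b (n + r) \<Longrightarrow>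
      sum_norm (B \<epsilon> z) \<le> \<beta> * C_norm_vec a b (n + r) z"
  shows "\<exists>\<delta>' \<kappa>. 0 < \<delta>' \<and> \<delta>' \<le> \<epsilon>0 \<and> 0 < \<kappa> \<and>
    (\<forall>\<epsilon>\<in>{0<..<\<delta>'}. \<forall>z\<in>C_space_vec a b (n + r). C_norm_vec a b (n + r) z
       \<le> \<kappa> * (C_norm_vec a b n (diff_op a b r (K \<epsilon>) z) + sum_norm (B \<epsilon> z)))"
    (is ?claim)
proof (rule ccontr)
  let ?X = "C_space_vec a b (n + r) :: (real \<Rightarrow> complex^'m) set"
    and ?N = "C_norm_vec a b (n + r) :: (real \<Rightarrow> complex^'m) \<Rightarrow> real"
    and ?Nf = "C_norm_vec a b n :: (real \<Rightarrow> complex^'m) \<Rightarrow> real"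
    and ?L = "\<lambda>\<epsilon>. diff_op a b r (K \<epsilon>)"
  assume contr: "\<not> ?thesis"
  have K0: "K 0 \<in> coeff_space a b n r" using K e0 by auto
  have L_space: "?L \<epsilon> z \<in> C_space_vec a b n" if "\<epsilon> \<in> {0..<\<epsilon>0}" "z \<in> ?X" for \<epsilon> z
    by (rule diff_op_space[OF r K[OF that(1)] that(2)])
  have "\<exists>\<epsilon> w. 0 < \<epsilon> \<and> \<epsilon> < min \<delta> (1 / real (Suc k)) \<and> w \<in> ?X \<and> ?N w = 1 \<and>
      ?Nf (?L \<epsilon> w) + sum_norm (B \<epsilon> w) < 1 / real (Suc k)" for k
  proof -
    have "0 < min \<delta> (1 / real (Suc k))" "min \<delta> (1 / real (Suc k)) \<le> \<epsilon>0" "0 < real (Suc k)"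
      using \<delta> by auto
    note bounds = this
    have "\<not> (\<forall>\<epsilon>\<in>{0<..<min \<delta> (1 / real (Suc k))}. \<forall>z\<in>?X.
        ?N z \<le> real (Suc k) * (?Nf (?L \<epsilon> z) + sum_norm (B \<epsilon> z)))"
    proof
      assume all: "\<forall>\<epsilon>\<in>{0<..<min \<delta> (1 / real (Suc k))}. \<forall>z\<in>?X.
        ?N z \<le> real (Suc k) * (?Nf (?L \<epsilon> z) + sum_norm (B \<epsilon> z))"
      have ?claim
        by (rule exI[of _ "min \<delta> (1 / real (Suc k))"], rule exI[of _ "real (Suc k)"])
          (intro conjI bounds all)
      with contr show False ..
    qed
    then obtain \<epsilon> z where eps: "0 < \<epsilon>" "\<epsilon> < min \<delta> (1 / real (Suc k))" and z: "z \<in> ?X"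
      and big: "real (Suc k) * (?Nf (?L \<epsilon> z) + sum_norm (B \<epsilon> z)) < ?N z"
      by (auto simp: not_le)
    have e: "\<epsilon> \<in> {0..<\<epsilon>0}" using eps \<delta> by auto
    have pos: "0 < ?N z"
      using big C_norm_vec_nonneg[OF L_space[OF e z]] sum_norm_nonneg[of "B \<epsilon> z"]
      by (smt (verit) mult_nonneg_nonneg of_nat_0_le_iff)
    define c where "c = complex_of_real (1 / ?N z)"
    have c: "norm c = 1 / ?N z" unfolding c_def using pos by (simp add: norm_divide)
    define w where "w = (\<lambda>t. c *s z t)"
    have w: "w \<in> ?X" unfolding w_def by (rule C_space_vec_scale[OF z])
    have Nw: "?N w = 1" unfolding w_def C_norm_vec_scale[OF z] c using pos by simp
    have Lw: "?Nf (?L \<epsilon> w) = norm c * ?Nf (?L \<epsilon> z)"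
      unfolding C_norm_vec_scale[OF L_space[OF e z], symmetric] w_def
      by (rule C_norm_vec_cong[OF diff_op_scale[OF z]])
    have Bw: "sum_norm (B \<epsilon> w) = norm c * sum_norm (B \<epsilon> z)"
      unfolding w_def continuous_linear_op_scale[OF B[OF e] z] sum_norm_scale ..
    have "?Nf (?L \<epsilon> w) + sum_norm (B \<epsilon> w) < 1 / real (Suc k)"
      unfolding Lw Bw distrib_left[symmetric] c using pos big by (simp add: field_simps)
    then show ?thesis using eps w Nw by blast
  qed
  then obtain \<epsilon> w where eps: "\<And>k. 0 < \<epsilon> k" "\<And>k. \<epsilon> k < min \<delta> (1 / real (Suc k))"
    and w: "\<And>k. w k \<in> ?X" "\<And>k. ?N (w k) = 1"
      "\<And>k. ?Nf (?L (\<epsilon> k) (w k)) + sum_norm (B (\<epsilon> k) (w k)) < 1 / real (Suc k)"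
    by metis
  have e: "\<epsilon> k \<in> {0..<\<epsilon>0}" "\<epsilon> k \<in> {0<..<\<delta>}" for k
    using eps[of k] \<delta> by auto
  have inv0: "(\<lambda>k. 1 / real (Suc k)) \<longlonglongrightarrow> 0"
    using LIMSEQ_inverse_real_of_nat by (simp add: inverse_eq_divide)
  have "\<epsilon> \<longlonglongrightarrow> 0"
    by (rule tendsto_sandwich[OF _ _ tendsto_const inv0])
      (use eps in \<open>auto intro!: always_eventually less_imp_le\<close>)
  moreover have "\<epsilon> k \<in> {0<..} \<and> \<epsilon> k \<noteq> 0" for k using eps(1)[of k] by simp
  ultimately have eps_lim: "filterlim \<epsilon> (at_right 0) sequentially"
    by (simp add: filterlim_at)
  have N0_nonneg: "0 \<le> ?Nf (?L (\<epsilon> k) (w k))" for k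
    by (rule C_norm_vec_nonneg[OF L_space[OF e(1) w(1)]])
  have L_lim: "(\<lambda>k. ?Nf (?L (\<epsilon> k) (w k))) \<longlonglongrightarrow> 0"
  proof (rule tendsto_sandwich[OF _ _ tendsto_const inv0])
    have "?Nf (?L (\<epsilon> k) (w k)) \<le> 1 / real (Suc k)" for k
      using w(3)[of k] sum_norm_nonneg[of "B (\<epsilon> k) (w k)"] by linarith
    then show "\<forall>\<^sub>F k in sequentially. ?Nf (?L (\<epsilon> k) (w k)) \<le> 1 / real (Suc k)" by simp
  qed (use N0_nonneg in simp)
  have Bw_lim: "(\<lambda>k. sum_norm (B (\<epsilon> k) (w k))) \<longlonglongrightarrow> 0"
  proof (rule tendsto_sandwich[OF _ _ tendsto_const inv0])
    have "sum_norm (B (\<epsilon> k) (w k)) \<le> 1 / real (Suc k)" for k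
      using w(3)[of k] N0_nonneg[of k] by linarith
    then show "\<forall>\<^sub>F k in sequentially. sum_norm (B (\<epsilon> k) (w k)) \<le> 1 / real (Suc k)" by simp
  qed (simp add: sum_norm_nonneg)
  have zero: "0 \<in> {0..<\<epsilon>0}" using e0 by simp
  have L0_lim: "(\<lambda>k. ?Nf (?L 0 (w k))) \<longlonglongrightarrow> 0"
  proof (rule tendsto_sandwich[OF _ _ tendsto_const])
    have "(\<lambda>k. coeff_norm a b n r (\<lambda>j t. K (\<epsilon> k) j t - K 0 j t)) \<longlonglongrightarrow> 0"
      by (rule filterlim_compose[OF K_lim eps_lim])
    then have "(\<lambda>k. ?Nf (?L (\<epsilon> k) (w k)) + 3 ^ n * coeff_norm a b n r (\<lambda>j t. K (\<epsilon> k) j t - K 0 j t))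
        \<longlonglongrightarrow> 0 + 3 ^ n * 0"
      by (intro tendsto_intros L_lim)
    then show "(\<lambda>k. ?Nf (?L (\<epsilon> k) (w k)) + 3 ^ n * coeff_norm a b n r (\<lambda>j t. K (\<epsilon> k) j t - K 0 j t))
        \<longlonglongrightarrow> 0" by simp
    have "?Nf (?L 0 (w k)) \<le> ?Nf (?L (\<epsilon> k) (w k)) + 3 ^ n * coeff_norm a b n r (\<lambda>j t. K (\<epsilon> k) j t - K 0 j t)"
      for k
    proof -
      have "?Nf (\<lambda>t. ?L (\<epsilon> k) (w k) t - (?L (\<epsilon> k) (w k) t - ?L 0 (w k) t))
        \<le> ?Nf (?L (\<epsilon> k) (w k)) + ?Nf (\<lambda>t. ?L (\<epsilon> k) (w k) t - ?L 0 (w k) t)"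
        by (intro C_norm_vec_triangle_diff C_space_vec_diff L_space e w zero)
      moreover have "?Nf (\<lambda>t. ?L (\<epsilon> k) (w k) t - ?L 0 (w k) t)
        \<le> 3 ^ n * coeff_norm a b n r (\<lambda>j t. K (\<epsilon> k) j t - K 0 j t) * ?N (w k)"
        by (rule diff_op_coeff_bound[OF K[OF e(1)] K0 w(1)])
      ultimately show ?thesis by (simp add: w(2))
    qed
    then show "\<forall>\<^sub>F k in sequentially. ?Nf (?L 0 (w k))
        \<le> ?Nf (?L (\<epsilon> k) (w k)) + 3 ^ n * coeff_norm a b n r (\<lambda>j t. K (\<epsilon> k) j t - K 0 j t)" by simp
    show "\<forall>\<^sub>F k in sequentially. 0 \<le> ?Nf (?L 0 (w k))"
      using C_norm_vec_nonneg[OF L_space[OF zero w(1)]] by simp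
  qed
  define C where "C = 1 + 3 ^ n * coeff_norm a b n r (K 0)"
  have C: "C > 0" unfolding C_def using coeff_norm_nonneg[OF K0] by (simp add: add_pos_nonneg)
  have Suc_eq: "Suc (n + r - 1) = n + r" using r by simp
  have "\<exists>s::nat \<Rightarrow> nat. strict_mono s \<and>
    (\<forall>e>0. \<exists>M. \<forall>m\<ge>M. \<forall>p\<ge>M. C_norm_vec a b (n + r - 1) (\<lambda>t. w (s m) t - w (s p) t) < e)"
    by (rule bounded_imp_Cauchy_subsequence[where M = 1]) (use w Suc_eq in auto)
  then obtain s :: "nat \<Rightarrow> nat" where s: "strict_mono s"
    and s_Cauchy: "\<And>e. e > 0 \<Longrightarrow> \<exists>M. \<forall>m\<ge>M. \<forall>p\<ge>M. C_norm_vec a b (n + r - 1) (\<lambda>t. w (s m) t - w (s p) t) < e"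
    by blast
  define v where "v k = w (s k)" for k
  define \<eta> where "\<eta> k = \<epsilon> (s k)" for k
  have v: "v k \<in> ?X" "?N (v k) = 1" for k using w by (auto simp: v_def)
  have s_lim: "filterlim s at_top sequentially" by (rule filterlim_subseq[OF s])
  have L0v_lim: "(\<lambda>k. ?Nf (?L 0 (v k))) \<longlonglongrightarrow> 0"
    unfolding v_def by (rule filterlim_compose[OF L0_lim s_lim])
  have Bv_lim: "(\<lambda>k. sum_norm (B (\<eta> k) (v k))) \<longlonglongrightarrow> 0"
    unfolding v_def \<eta>_def by (rule filterlim_compose[OF Bw_lim s_lim])
  have \<eta>_lim: "filterlim \<eta> (at_right 0) sequentially"
    unfolding \<eta>_def by (rule filterlim_compose[OF eps_lim s_lim])
  \<comment> \<open>From Cauchy in order \<open>n + r - 1\<close> to Cauchy in order \<open>n + r\<close>, by the a priori estimate.\<close>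
  have "\<exists>M. \<forall>m\<ge>M. \<forall>p\<ge>M. ?N (\<lambda>t. v m t - v p t) < d" if "d > 0" for d
  proof -
    have "d / (4 * C) > 0" using \<open>d > 0\<close> C by simp
    from s_Cauchy[OF this] obtain M1 where M1: "\<And>m p. m \<ge> M1 \<Longrightarrow> p \<ge> M1 \<Longrightarrow>
      C_norm_vec a b (n + r - 1) (\<lambda>t. v m t - v p t) < d / (4 * C)"
      unfolding v_def by blast
    have "\<forall>\<^sub>F k in sequentially. ?Nf (?L 0 (v k)) < d / 4"
      using order_tendstoD(2)[OF L0v_lim, of "d / 4"] \<open>d > 0\<close> by simp
    then obtain M2 where M2: "\<And>k. k \<ge> M2 \<Longrightarrow> ?Nf (?L 0 (v k)) < d / 4"
      unfolding eventually_sequentially by blast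
    have "?N (\<lambda>t. v m t - v p t) < d" if "m \<ge> max M1 M2" "p \<ge> max M1 M2" for m p
    proof -
      have "?N (\<lambda>t. v m t - v p t) \<le> ?Nf (?L 0 (\<lambda>t. v m t - v p t))
          + C * C_norm_vec a b (n + r - 1) (\<lambda>t. v m t - v p t)"
        unfolding C_def by (rule diff_op_a_priori[OF r K0 C_space_vec_diff[OF v(1) v(1)]])
      moreover have "?Nf (?L 0 (\<lambda>t. v m t - v p t)) \<le> ?Nf (?L 0 (v m)) + ?Nf (?L 0 (v p))"
      proof -
        have "?Nf (?L 0 (\<lambda>t. v m t - v p t)) = ?Nf (\<lambda>t. ?L 0 (v m) t - ?L 0 (v p) t)"
          by (rule C_norm_vec_cong[OF diff_op_diff[OF v(1) v(1)]])
        also have "\<dots> \<le> ?Nf (?L 0 (v m)) + ?Nf (?L 0 (v p))"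
          by (intro C_norm_vec_triangle_diff L_space zero v)
        finally show ?thesis .
      qed
      moreover have "C * C_norm_vec a b (n + r - 1) (\<lambda>t. v m t - v p t) < d / 4"
        using M1[of m p] that C by (simp add: field_simps)
      moreover have "?Nf (?L 0 (v m)) < d / 4" "?Nf (?L 0 (v p)) < d / 4" using M2 that by auto
      ultimately show ?thesis using \<open>d > 0\<close> by linarith
    qed
    then show ?thesis by blast
  qed
  from C_space_vec_complete[OF v(1) this] obtain g where g: "g \<in> ?X"
    "(\<lambda>k. ?N (\<lambda>t. v k t - g t)) \<longlonglongrightarrow> 0" by blast
  note vg = C_space_vec_diff[OF v(1) g(1)]
  have "?Nf (?L 0 g) \<le> 0"
  proof (rule tendsto_lowerbound)
    have "(\<lambda>k. ?Nf (?L 0 (v k)) + C * ?N (\<lambda>t. v k t - g t)) \<longlonglongrightarrow> 0 + C * 0"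
      by (intro tendsto_intros L0v_lim g)
    then show "(\<lambda>k. ?Nf (?L 0 (v k)) + C * ?N (\<lambda>t. v k t - g t)) \<longlonglongrightarrow> 0" by simp
    have "?Nf (?L 0 g) \<le> ?Nf (?L 0 (v k)) + C * ?N (\<lambda>t. v k t - g t)" for k
    proof -
      have "?Nf (?L 0 g) = ?Nf (\<lambda>t. ?L 0 (v k) t - ?L 0 (\<lambda>t. v k t - g t) t)"
        by (rule C_norm_vec_cong) (simp add: diff_op_diff[OF v(1) g(1)])
      also have "\<dots> \<le> ?Nf (?L 0 (v k)) + ?Nf (?L 0 (\<lambda>t. v k t - g t))"
        by (intro C_norm_vec_triangle_diff L_space zero v vg)
      also have "?Nf (?L 0 (\<lambda>t. v k t - g t)) \<le> C * ?N (\<lambda>t. v k t - g t)"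
        unfolding C_def by (rule diff_op_bound[OF r K0 vg])
      finally show ?thesis by simp
    qed
    then show "\<forall>\<^sub>F k in sequentially. ?Nf (?L 0 g) \<le> ?Nf (?L 0 (v k)) + C * ?N (\<lambda>t. v k t - g t)" by simp
  qed simp
  then have Lg: "?L 0 g t = 0" if "t \<in> {a..b}" for t
    using norm_component_le_C_norm_vec[OF L_space[OF zero g(1)] that]
    by (smt (verit) norm_le_zero_iff vec_eq_iff zero_index)
  have "sum_norm (B 0 g) \<le> 0"
  proof (rule tendsto_lowerbound)
    have "(\<lambda>k. sum_norm (B (\<eta> k) g - B 0 g)) \<longlonglongrightarrow> 0"
      by (rule tendsto_sum_norm[OF filterlim_compose[OF B_lim[OF g(1)] \<eta>_lim]])
    then have "(\<lambda>k. sum_norm (B (\<eta> k) g - B 0 g) + (sum_norm (B (\<eta> k) (v k)) + \<beta> * ?N (\<lambda>t. v k t - g t)))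
        \<longlonglongrightarrow> 0 + (0 + \<beta> * 0)"
      by (intro tendsto_intros Bv_lim g)
    then show "(\<lambda>k. sum_norm (B (\<eta> k) g - B 0 g) + (sum_norm (B (\<eta> k) (v k)) + \<beta> * ?N (\<lambda>t. v k t - g t)))
        \<longlonglongrightarrow> 0" by simp
    have "sum_norm (B 0 g) \<le> sum_norm (B (\<eta> k) g - B 0 g) + (sum_norm (B (\<eta> k) (v k)) + \<beta> * ?N (\<lambda>t. v k t - g t))"
      for k
    proof -
      have "sum_norm (B 0 g) \<le> sum_norm (B (\<eta> k) g) + sum_norm (B (\<eta> k) g - B 0 g)"
        using sum_norm_triangle_diff[of "B (\<eta> k) g" "B (\<eta> k) g - B 0 g"] by simp
      moreover have "sum_norm (B (\<eta> k) g) \<le> sum_norm (B (\<eta> k) (v k)) + sum_norm (B (\<eta> k) (\<lambda>t. v k t - g t))"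
        using sum_norm_triangle_diff[of "B (\<eta> k) (v k)" "B (\<eta> k) (v k) - B (\<eta> k) g"]
          continuous_linear_op_diff[OF B[OF e(1)] v(1) g(1), of "s k" k] by (simp add: \<eta>_def)
      moreover have "sum_norm (B (\<eta> k) (\<lambda>t. v k t - g t)) \<le> \<beta> * ?N (\<lambda>t. v k t - g t)"
        unfolding \<eta>_def by (rule \<beta>[OF e(2) vg])
      ultimately show ?thesis by linarith
    qed
    then show "\<forall>\<^sub>F k in sequentially. sum_norm (B 0 g)
      \<le> sum_norm (B (\<eta> k) g - B 0 g) + (sum_norm (B (\<eta> k) (v k)) + \<beta> * ?N (\<lambda>t. v k t - g t))" by simp
  qed simp
  then have "B 0 g = 0" using sum_norm_nonneg[of "B 0 g"] by (intro sum_norm_eq_0) simp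
  then have "bvp_solution a b n r (K 0) (B 0) (\<lambda>t. 0) 0 g"
    using g(1) Lg by (simp add: bvp_solution_def)
  then have g0: "\<And>t. t \<in> {a..b} \<Longrightarrow> g t = 0" using inj by blast
  have "?N (\<lambda>t. v k t - g t) = 1" for k
    using C_norm_vec_cong[of "\<lambda>t. v k t - g t" "v k"] g0 v(2) by simp
  with g(2) have "(\<lambda>k::nat. 1::real) \<longlonglongrightarrow> 0" by simp
  then show False by (simp add: LIMSEQ_const_iff)
qed

end

section \<open>The two-sided estimate\<close>
theorem mainTheorem2:
  fixes a b :: real and n r :: nat and \<epsilon>0 \<epsilon>1 :: real
    and K :: "real \<Rightarrow> nat \<Rightarrow> real \<Rightarrow> complex^'m^'m"
    and B :: "real \<Rightarrow> (real \<Rightarrow> complex^'m) \<Rightarrow> complex^'k"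
  assumes "a < b" and "r \<ge> 1" and "CARD('k) = r * CARD('m)" and "\<epsilon>0 > 0"
    and K_space: "\<And>\<epsilon> j. \<epsilon> \<in> {0..<\<epsilon>0} \<Longrightarrow> j \<in> {1..r} \<Longrightarrow> K \<epsilon> (r - j) \<in> C_space_mat a b n"
    and B_op: "\<And>\<epsilon>. \<epsilon> \<in> {0..<\<epsilon>0} \<Longrightarrow> continuous_linear_op a b (n + r) (B \<epsilon>)"
    and cond_0: "\<And>z. bvp_solution a b n r (K 0) (B 0) (\<lambda>t. 0) 0 z \<Longrightarrow> (\<forall>t\<in>{a..b}. z t = 0)"
    and cond_I: "\<And>j. j \<in> {1..r} \<Longrightarrow>
      ((\<lambda>\<epsilon>. C_norm_mat a b n (\<lambda>t. K \<epsilon> (r - j) t - K 0 (r - j) t)) \<longlongrightarrow> 0) (at_right 0)"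
    and cond_II: "\<And>z. z \<in> C_space_vec a b (n + r) \<Longrightarrow> ((\<lambda>\<epsilon>. B \<epsilon> z) \<longlongrightarrow> B 0 z) (at_right 0)"
    and "\<epsilon>1 \<in> {0<..<\<epsilon>0}"
    and unique_solvability: "\<And>\<epsilon> f q. \<epsilon> \<in> {0..<\<epsilon>1} \<Longrightarrow> f \<in> C_space_vec a b n \<Longrightarrow>
      \<exists>z. bvp_solution a b n r (K \<epsilon>) (B \<epsilon>) f q z \<and>
          (\<forall>w. bvp_solution a b n r (K \<epsilon>) (B \<epsilon>) f q w \<longrightarrow> (\<forall>t\<in>{a..b}. w t = z t))"
  shows "\<exists>\<epsilon>2 \<kappa>1 \<kappa>2. 0 < \<epsilon>2 \<and> \<epsilon>2 < \<epsilon>1 \<and> 0 < \<kappa>1 \<and> 0 < \<kappa>2 \<and>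
    (\<forall>(f :: real \<Rightarrow> real \<Rightarrow> complex^'m) (q :: real \<Rightarrow> complex^'k) (z :: real \<Rightarrow> real \<Rightarrow> complex^'m).
       (\<forall>\<epsilon>\<in>{0..<\<epsilon>0}. f \<epsilon> \<in> C_space_vec a b n) \<longrightarrow>
       (\<forall>\<epsilon>\<in>{0..<\<epsilon>1}. bvp_solution a b n r (K \<epsilon>) (B \<epsilon>) (f \<epsilon>) (q \<epsilon>) (z \<epsilon>)) \<longrightarrow>
       (\<forall>\<epsilon>\<in>{0<..<\<epsilon>2}.
          let d = C_norm_vec a b n (\<lambda>t. diff_op a b r (K \<epsilon>) (z 0) t - f \<epsilon> t)
                  + sum_norm (B \<epsilon> (z 0) - q \<epsilon>)
          in \<kappa>1 * d \<le> C_norm_vec a b (n + r) (\<lambda>t. z 0 t - z \<epsilon> t) \<and>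
             C_norm_vec a b (n + r) (\<lambda>t. z 0 t - z \<epsilon> t) \<le> \<kappa>2 * d))"
proof -
  note ab = \<open>a < b\<close> and r = \<open>r \<ge> 1\<close> and e0 = \<open>\<epsilon>0 > 0\<close>
  let ?X = "C_space_vec a b (n + r) :: (real \<Rightarrow> complex^'m) set"
    and ?N = "C_norm_vec a b (n + r) :: (real \<Rightarrow> complex^'m) \<Rightarrow> real"
    and ?Nf = "C_norm_vec a b n :: (real \<Rightarrow> complex^'m) \<Rightarrow> real"
    and ?L = "\<lambda>\<epsilon>. diff_op a b r (K \<epsilon>)"
  have K: "K \<epsilon> \<in> coeff_space a b n r" if "\<epsilon> \<in> {0..<\<epsilon>0}" for \<epsilon>
    using K_space that by (simp add: coeff_space_def)
  have K0: "K 0 \<in> coeff_space a b n r" using K e0 by auto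
  have zero: "0 \<in> {0..<\<epsilon>0}" using e0 by simp
  have B_bounded: "\<exists>M. \<forall>\<^sub>F \<epsilon> in at_right 0. sum_norm (B \<epsilon> z) \<le> M" if "z \<in> ?X" for z
  proof -
    have "\<forall>\<^sub>F \<epsilon> in at_right 0. sum_norm (B \<epsilon> z - B 0 z) < 1"
      using order_tendstoD(2)[OF tendsto_sum_norm[OF cond_II[OF that]], of 1] by simp
    then have "\<forall>\<^sub>F \<epsilon> in at_right 0. sum_norm (B \<epsilon> z) \<le> sum_norm (B 0 z) + 1"
    proof (rule eventually_mono)
      fix \<epsilon> assume "sum_norm (B \<epsilon> z - B 0 z) < 1"
      then show "sum_norm (B \<epsilon> z) \<le> sum_norm (B 0 z) + 1"
        using sum_norm_triangle[of "B 0 z" "B \<epsilon> z - B 0 z"] by simp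
    qed
    then show ?thesis by blast
  qed
  have B_pos: "continuous_linear_op a b (n + r) (B \<epsilon>)" if "\<epsilon> \<in> {0<..<\<epsilon>0}" for \<epsilon>
    using B_op that by simp
  obtain \<delta> \<beta> where \<delta>: "0 < \<delta>" "\<delta> \<le> \<epsilon>0" and
    \<beta>: "0 < \<beta>" "\<And>\<epsilon> z. \<epsilon> \<in> {0<..<\<delta>} \<Longrightarrow> z \<in> ?X \<Longrightarrow> sum_norm (B \<epsilon> z) \<le> \<beta> * ?N z"
    using uniform_boundedness[where B = B, OF ab e0 B_pos B_bounded] by blast
  have K_lim: "((\<lambda>\<epsilon>. coeff_norm a b n r (\<lambda>j t. K \<epsilon> j t - K 0 j t)) \<longlongrightarrow> 0) (at_right 0)"
    unfolding coeff_norm_def using tendsto_sum[of "{1..r}", OF cond_I] by simp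
  obtain \<delta>' \<kappa> where \<delta>': "0 < \<delta>'" "\<delta>' \<le> \<epsilon>0" and \<kappa>: "0 < \<kappa>"
    "\<And>\<epsilon> z. \<epsilon> \<in> {0<..<\<delta>'} \<Longrightarrow> z \<in> ?X \<Longrightarrow> ?N z \<le> \<kappa> * (?Nf (?L \<epsilon> z) + sum_norm (B \<epsilon> z))"
    using uniform_inverse_bound[OF ab r e0 K B_op cond_0 K_lim cond_II \<delta> \<beta>(2)] by blast
  have "\<forall>\<^sub>F \<epsilon> in at_right 0. coeff_norm a b n r (\<lambda>j t. K \<epsilon> j t - K 0 j t) < 1"
    using order_tendstoD(2)[OF K_lim, of 1] by simp
  then obtain \<delta>'' where \<delta>'': "\<delta>'' > 0"
    "\<And>\<epsilon>. 0 < \<epsilon> \<Longrightarrow> \<epsilon> < \<delta>'' \<Longrightarrow> coeff_norm a b n r (\<lambda>j t. K \<epsilon> j t - K 0 j t) < 1"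
    unfolding eventually_at_right_field by auto
  \<comment> \<open>Bounds for \<open>L 0\<close>, for \<open>L \<epsilon> - L 0\<close> (using that the coefficients differ by less than 1) and for \<open>B \<epsilon>\<close>.\<close>
  define C where "C = (1 + 3 ^ n * coeff_norm a b n r (K 0)) + 3 ^ n + \<beta>"
  have C: "C > 0"
    unfolding C_def using coeff_norm_nonneg[OF ab K0] \<beta>(1) by (simp add: add_pos_nonneg add_nonneg_pos)
  define \<epsilon>2 where "\<epsilon>2 = min (\<epsilon>1 / 2) (min \<delta> (min \<delta>' \<delta>''))"
  have upper: "?Nf (?L \<epsilon> z) + sum_norm (B \<epsilon> z) \<le> C * ?N z" if "\<epsilon> \<in> {0<..<\<epsilon>2}" and z: "z \<in> ?X" for \<epsilon> z
  proof -
    have e: "\<epsilon> \<in> {0..<\<epsilon>0}" "\<epsilon> \<in> {0<..<\<delta>}" "0 < \<epsilon>" "\<epsilon> < \<delta>''" using that \<delta> by (auto simp: \<epsilon>2_def)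
    note Ls = diff_op_space[OF ab r K0 z] diff_op_space[OF ab r K[OF e(1)] z]
    have "?Nf (\<lambda>t. ?L 0 z t + (?L \<epsilon> z t - ?L 0 z t)) \<le> ?Nf (?L 0 z) + ?Nf (\<lambda>t. ?L \<epsilon> z t - ?L 0 z t)"
      by (intro C_norm_vec_triangle[OF ab] C_space_vec_diff[OF ab] Ls)
    moreover have "?Nf (?L 0 z) \<le> (1 + 3 ^ n * coeff_norm a b n r (K 0)) * ?N z"
      by (rule diff_op_bound[OF ab r K0 z])
    moreover have "?Nf (\<lambda>t. ?L \<epsilon> z t - ?L 0 z t) \<le> 3 ^ n * ?N z"
    proof -
      have "?Nf (\<lambda>t. ?L \<epsilon> z t - ?L 0 z t)
          \<le> 3 ^ n * coeff_norm a b n r (\<lambda>j t. K \<epsilon> j t - K 0 j t) * ?N z"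
        by (rule diff_op_coeff_bound[OF ab K[OF e(1)] K0 z])
      also have "\<dots> \<le> 3 ^ n * 1 * ?N z"
        using \<delta>''(2)[OF e(3,4)] by (intro mult_right_mono mult_left_mono C_norm_vec_nonneg[OF ab z]) auto
      finally show ?thesis by simp
    qed
    moreover have "sum_norm (B \<epsilon> z) \<le> \<beta> * ?N z" by (rule \<beta>(2)[OF e(2) z])
    ultimately show ?thesis by (simp add: C_def algebra_simps)
  qed
  show ?thesis
  proof (rule exI[of _ \<epsilon>2], rule exI[of _ "1 / C"], rule exI[of _ \<kappa>], intro conjI allI impI ballI)
    show "0 < \<epsilon>2" "\<epsilon>2 < \<epsilon>1" "0 < 1 / C" "0 < \<kappa>"
      using \<open>\<epsilon>1 \<in> {0<..<\<epsilon>0}\<close> \<delta> \<delta>' \<delta>'' C \<kappa> by (auto simp: \<epsilon>2_def)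
    fix f :: "real \<Rightarrow> real \<Rightarrow> complex^'m" and q :: "real \<Rightarrow> complex^'k" and z and \<epsilon>
    assume f: "\<forall>\<epsilon>\<in>{0..<\<epsilon>0}. f \<epsilon> \<in> C_space_vec a b n"
      and sol: "\<forall>\<epsilon>\<in>{0..<\<epsilon>1}. bvp_solution a b n r (K \<epsilon>) (B \<epsilon>) (f \<epsilon>) (q \<epsilon>) (z \<epsilon>)"
      and eps: "\<epsilon> \<in> {0<..<\<epsilon>2}"
    have e: "\<epsilon> \<in> {0..<\<epsilon>0}" "\<epsilon> \<in> {0..<\<epsilon>1}" "0 \<in> {0..<\<epsilon>1}" "\<epsilon> \<in> {0<..<\<delta>'}"
      using eps \<open>\<epsilon>1 \<in> {0<..<\<epsilon>0}\<close> by (auto simp: \<epsilon>2_def)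
    have z: "z 0 \<in> ?X" "z \<epsilon> \<in> ?X" and Lz: "\<And>t. t \<in> {a..b} \<Longrightarrow> ?L \<epsilon> (z \<epsilon>) t = f \<epsilon> t" and Bz: "B \<epsilon> (z \<epsilon>) = q \<epsilon>"
      using sol e unfolding bvp_solution_def by blast+
    \<comment> \<open>The discrepancy is the image of the error \<open>w\<close> under the operator pair with parameter \<open>\<epsilon>\<close>.\<close>
    define w where "w = (\<lambda>t. z 0 t - z \<epsilon> t)"
    have w: "w \<in> ?X" unfolding w_def by (rule C_space_vec_diff[OF ab z])
    have Lw: "?Nf (\<lambda>t. ?L \<epsilon> (z 0) t - f \<epsilon> t) = ?Nf (?L \<epsilon> w)"
      unfolding w_def by (rule C_norm_vec_cong[OF ab]) (simp add: diff_op_diff[OF ab z] Lz)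
    have Bw: "B \<epsilon> (z 0) - q \<epsilon> = B \<epsilon> w"
      unfolding w_def continuous_linear_op_diff[OF ab B_op[OF e(1)] z] Bz ..
    show "let d = ?Nf (\<lambda>t. ?L \<epsilon> (z 0) t - f \<epsilon> t) + sum_norm (B \<epsilon> (z 0) - q \<epsilon>)
          in 1 / C * d \<le> ?N (\<lambda>t. z 0 t - z \<epsilon> t) \<and> ?N (\<lambda>t. z 0 t - z \<epsilon> t) \<le> \<kappa> * d"
      unfolding Let_def Lw Bw w_def[symmetric]
      using upper[OF eps w] \<kappa>(2)[OF e(4) w] C by (simp add: field_simps)
  qed
qed

end
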